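(* There exists a constant $r_0$ such that if $\lambda>0$, $s\in[0,1]$ satisfy $\lambda s>r_0$ and $1-s\le\frac{1}{3+\eta}\sqrt{\frac{\log(\lambda s)}{\lambda^3 s}}$ for some $\eta>0$, then there exists a one-sided test for deciding $\mathbb P_{0,d}$ versus $\mathbb P_{1,d}$ (one-sided detectability of tree correlation holds).
   Context: Rooted trees are canonically labeled (root $\varnothing$; children of a node labeled $m$ with $c$ children are $\{m,1\},\dots,\{m,c\}$); $\mathcal X_n$ is the set of such trees of depth $\le n$, $p_n$ the pruning at depth $n$. $\mathrm{GW}_\mu$: law of a Galton–Watson tree with $\mathrm{Poisson}(\mu)$ offspring. Uniform random relabeling: independently at each node permute its children uniformly, then relabel canonically. A $(\lambda,s)$-augmentation of $\tau$ attaches to each node an independent $\mathrm{Poisson}(\lambda(1-s))$ number of new children, each receiving an independent $\mathrm{GW}_\lambda$ tree. Under $\mathbb P_0$, $(\mathbf t,\mathbf t')$ are independent $\mathrm{GW}_\lambda$ trees; under $\mathbb P_1$, $\boldsymbol\tau^*\sim\mathrm{GW}_{\lambda s}$ and $\mathbf t,\mathbf t'$ are independent uniform relabelings of two independent $(\lambda,s)$-augmentations of $\boldsymbol\tau^*$. $\mathbb P_{i,n}$ is the law of $(p_n(\mathbf t),p_n(\mathbf t'))$ under $\mathbb P_i$. A one-sided test is a sequence $\mathcal T_n:\mathcal X_n^2\to\{0,1\}$ with $\mathbb P_{0,n}(\mathcal T_n=1)\to0$ and $\liminf_n\mathbb P_{1,n}(\mathcal T_n=1)>0$. *)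

theory Defs
  imports "HOL-Probability.Probability" "HOL-Combinatorics.Permutations"
begin

section \<open>Canonically labelled trees\<close>

text \<open>A tree is identified with its set of labels. The root is the empty list and
  the children of \<open>m\<close> are \<open>m @ [1], \<dots>, m @ [c]\<close>. Trees may be infinite, but every node has
  finitely many children.\<close>

type_synonym label = "nat list"
type_synonym tree = "label set"

definition canonical_tree :: "tree \<Rightarrow> bool" where
  "canonical_tree t \<longleftrightarrow>
     [] \<in> t \<and>
     (\<forall>m i. m @ [i] \<in> t \<longrightarrow> m \<in> t) \<and>
     (\<forall>m\<in>t. \<exists>c. \<forall>i. m @ [i] \<in> t \<longleftrightarrow> i \<in> {1..c})"

definition num_children :: "tree \<Rightarrow> label \<Rightarrow> nat" where
  "num_children t m = card {i. m @ [i] \<in> t}"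

definition prune :: "nat \<Rightarrow> tree \<Rightarrow> tree" where
  "prune n t = {m \<in> t. length m \<le> n}"

definition trees_upto :: "nat \<Rightarrow> tree set" where
  "trees_upto n = {t. canonical_tree t \<and> (\<forall>m\<in>t. length m \<le> n)}"


section \<open>Galton--Watson trees\<close>

text \<open>\<^const>\<open>poisson_pmf\<close> is only specified for positive rates; the rate 0, which is needed for
  \<open>s = 1\<close> in the augmentation below, gives the Dirac mass at 0.\<close>

definition poisson :: "real \<Rightarrow> nat pmf" where
  "poisson \<mu> = (if \<mu> = 0 then return_pmf 0 else poisson_pmf \<mu>)"

text \<open>The tree in which each node \<open>m\<close> has \<open>c m\<close> children. Its law, when the \<open>c m\<close> are independent
  \<open>Poisson \<mu>\<close> variables, is the Galton--Watson law; the values of \<open>c\<close> outside the tree are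
  irrelevant.\<close>

definition tree_of :: "(label \<Rightarrow> nat) \<Rightarrow> tree" where
  "tree_of c = {m. \<forall>k<length m. m ! k \<in> {1..c (take k m)}}"

definition gw_space :: "real \<Rightarrow> (label \<Rightarrow> nat) measure" where
  "gw_space \<mu> = PiM UNIV (\<lambda>_. measure_pmf (poisson \<mu>))"


section \<open>Augmentation and relabelling\<close>

text \<open>\<open>N m\<close> is the number of new children of the node \<open>m\<close> of \<open>\<tau>\<close>. They are labelled after the
  children that \<open>m\<close> already has, and the \<open>j\<close>-th of them is the root of a copy of the tree with
  offspring numbers \<open>G (m, j)\<close>.\<close>

type_synonym aug_sample = "(label \<Rightarrow> nat) \<times> (label \<times> nat \<Rightarrow> label \<Rightarrow> nat)"

definition augment :: "aug_sample \<Rightarrow> tree \<Rightarrow> tree" where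
  "augment a \<tau> = (case a of (N, G) \<Rightarrow>
     \<tau> \<union> {m @ (num_children \<tau> m + j) # v | m j v.
            m \<in> \<tau> \<and> j \<in> {1..N m} \<and> v \<in> tree_of (G (m, j))})"

definition aug_space :: "real \<Rightarrow> real \<Rightarrow> aug_sample measure" where
  "aug_space lam s =
     PiM UNIV (\<lambda>_. measure_pmf (poisson (lam * (1 - s)))) \<Otimes>\<^sub>M PiM UNIV (\<lambda>_. gw_space lam)"

text \<open>A node \<open>m\<close> with \<open>c\<close> children has them permuted by \<open>\<sigma> (m, c)\<close>; the permutations are drawn for
  all pairs \<open>(m, c)\<close> so that the sample space does not depend on the tree. The new label of a node
  is found by permuting each entry of its label with the permutation at the corresponding
  ancestor.\<close>

type_synonym relabel_sample = "label \<times> nat \<Rightarrow> nat \<Rightarrow> nat"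

definition new_label :: "relabel_sample \<Rightarrow> tree \<Rightarrow> label \<Rightarrow> label" where
  "new_label \<sigma> t m =
     map (\<lambda>k. \<sigma> (take k m, num_children t (take k m)) (m ! k)) [0..<length m]"

definition relabel :: "relabel_sample \<Rightarrow> tree \<Rightarrow> tree" where
  "relabel \<sigma> t = new_label \<sigma> t ` t"

definition relabel_space :: "relabel_sample measure" where
  "relabel_space = PiM UNIV (\<lambda>(m, c). uniform_count_measure {\<pi>. \<pi> permutes {1..c}})"


section \<open>The two hypotheses\<close>

definition null_space :: "real \<Rightarrow> ((label \<Rightarrow> nat) \<times> (label \<Rightarrow> nat)) measure" where
  "null_space lam = gw_space lam \<Otimes>\<^sub>M gw_space lam"

definition null_trees :: "(label \<Rightarrow> nat) \<times> (label \<Rightarrow> nat) \<Rightarrow> tree \<times> tree" where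
  "null_trees = (\<lambda>(c, c'). (tree_of c, tree_of c'))"

type_synonym planted_sample =
  "(label \<Rightarrow> nat) \<times> (aug_sample \<times> relabel_sample) \<times> (aug_sample \<times> relabel_sample)"

definition planted_space :: "real \<Rightarrow> real \<Rightarrow> planted_sample measure" where
  "planted_space lam s =
     gw_space (lam * s) \<Otimes>\<^sub>M
       ((aug_space lam s \<Otimes>\<^sub>M relabel_space) \<Otimes>\<^sub>M (aug_space lam s \<Otimes>\<^sub>M relabel_space))"

definition planted_trees :: "planted_sample \<Rightarrow> tree \<times> tree" where
  "planted_trees = (\<lambda>(c, (a, \<sigma>), (a', \<sigma>')).
     (relabel \<sigma> (augment a (tree_of c)), relabel \<sigma>' (augment a' (tree_of c))))"

definition null_law :: "real \<Rightarrow> nat \<Rightarrow> (tree \<times> tree) measure" where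
  "null_law lam n = distr (null_space lam) (count_space (trees_upto n \<times> trees_upto n))
     (\<lambda>\<omega>. map_prod (prune n) (prune n) (null_trees \<omega>))"

definition planted_law :: "real \<Rightarrow> real \<Rightarrow> nat \<Rightarrow> (tree \<times> tree) measure" where
  "planted_law lam s n = distr (planted_space lam s) (count_space (trees_upto n \<times> trees_upto n))
     (\<lambda>\<omega>. map_prod (prune n) (prune n) (planted_trees \<omega>))"


section \<open>One-sided tests\<close>

definition one_sided_test :: "real \<Rightarrow> real \<Rightarrow> (nat \<Rightarrow> tree \<times> tree \<Rightarrow> nat) \<Rightarrow> bool" where
  "one_sided_test lam s T \<longleftrightarrow>
     (\<forall>n. T n \<in> trees_upto n \<times> trees_upto n \<rightarrow> {0, 1}) \<and>
     (\<lambda>n. measure (null_law lam n) {x \<in> trees_upto n \<times> trees_upto n. T n x = 1}) \<longlonglongrightarrow> 0 \<and>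
     liminf (\<lambda>n. ereal (measure (planted_law lam s n)
       {x \<in> trees_upto n \<times> trees_upto n. T n x = 1})) > 0"


section \<open>The laws are well defined\<close>

text \<open>The random trees above are canonical trees, their prunings are measurable, and hence both laws
  are probability measures on pairs of trees of bounded depth.\<close>

lemma canonical_treeI:
  assumes "[] \<in> t" "\<And>m i. m @ [i] \<in> t \<Longrightarrow> m \<in> t"
    "\<And>m. m \<in> t \<Longrightarrow> \<exists>c. \<forall>i. m @ [i] \<in> t \<longleftrightarrow> i \<in> {1..c}"
  shows "canonical_tree t"
  unfolding canonical_tree_def
  by (intro conjI allI impI ballI) (rule assms, assumption?)+

lemma canonical_tree_Nil: "canonical_tree t \<Longrightarrow> [] \<in> t"
  unfolding canonical_tree_def by (erule conjunct1)

lemma canonical_tree_snocD: "canonical_tree t \<Longrightarrow> m @ [i] \<in> t \<Longrightarrow> m \<in> t"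
  unfolding canonical_tree_def by (elim conjE) (erule allE[of _ m], erule allE[of _ i], erule (1) mp)

lemma canonical_tree_finite_children:
  "canonical_tree t \<Longrightarrow> m \<in> t \<Longrightarrow> \<exists>c. \<forall>i. m @ [i] \<in> t \<longleftrightarrow> i \<in> {1..c}"
  unfolding canonical_tree_def by (elim conjE) (erule (1) bspec)

lemma canonical_tree_prefixD:
  assumes "canonical_tree t" shows "m @ v \<in> t \<Longrightarrow> m \<in> t"
proof (induction v rule: rev_induct)
  case (snoc i v)
  then have "(m @ v) @ [i] \<in> t" by simp
  then show ?case by (rule snoc.IH[OF canonical_tree_snocD[OF assms]])
qed simp

lemma canonical_tree_children:
  assumes "canonical_tree t" "m \<in> t"
  shows "m @ [i] \<in> t \<longleftrightarrow> i \<in> {1..num_children t m}"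
proof -
  obtain c where c: "\<And>i. m @ [i] \<in> t \<longleftrightarrow> i \<in> {1..c}"
    using canonical_tree_finite_children[OF assms] by auto
  then have "{i. m @ [i] \<in> t} = {1..c}" by blast
  then have "num_children t m = c" by (simp add: num_children_def)
  then show ?thesis using c by simp
qed

lemma tree_of_snoc: "m @ [i] \<in> tree_of c \<longleftrightarrow> m \<in> tree_of c \<and> i \<in> {1..c m}"
  by (auto simp: tree_of_def nth_append less_Suc_eq)

lemma canonical_tree_of: "canonical_tree (tree_of c)"
proof -
  have "[] \<in> tree_of c" by (simp add: tree_of_def)
  then show ?thesis
    by (rule canonical_treeI) (auto simp: tree_of_snoc)
qed

lemma augment_iff:
  "x \<in> augment (N, G) \<tau> \<longleftrightarrow> x \<in> \<tau> \<or>
     (\<exists>m j v. x = m @ (num_children \<tau> m + j) # v \<and>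
        m \<in> \<tau> \<and> j \<in> {1..N m} \<and> v \<in> tree_of (G (m, j)))"
  unfolding augment_def prod.case Un_iff mem_Collect_eq ..

lemma canonical_augment:
  assumes \<tau>: "canonical_tree \<tau>" shows "canonical_tree (augment a \<tau>)"
proof -
  obtain N G where a: "a = (N, G)" by (cases a)
  define c where "c = num_children \<tau>"
  define A where "A = augment a \<tau>"
  have A_iff: "x \<in> A \<longleftrightarrow> x \<in> \<tau> \<or>
     (\<exists>m j v. x = m @ (c m + j) # v \<and> m \<in> \<tau> \<and> j \<in> {1..N m} \<and> v \<in> tree_of (G (m, j)))" for x
    unfolding A_def c_def a by (rule augment_iff)
  have A_old: "x \<in> A" if "x \<in> \<tau>" for x
    using that by (simp add: A_iff)
  have A_new: "m @ (c m + j) # v \<in> A" if "m \<in> \<tau>" "j \<in> {1..N m}" "v \<in> tree_of (G (m, j))" for m j v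
    using that unfolding A_iff by blast
  have A_cases: thesis if "x \<in> A" "x \<in> \<tau> \<Longrightarrow> thesis"
    "\<And>m j v. x = m @ (c m + j) # v \<Longrightarrow> m \<in> \<tau> \<Longrightarrow> j \<in> {1..N m} \<Longrightarrow> v \<in> tree_of (G (m, j)) \<Longrightarrow> thesis"
    for x thesis
    using that(1)[unfolded A_iff] that(2,3) by blast
  have no: "m @ (c m + j) # v \<notin> \<tau>" if "m \<in> \<tau>" "j \<in> {1..N m}" for m j v
  proof
    assume "m @ (c m + j) # v \<in> \<tau>"
    then have "(m @ [c m + j]) @ v \<in> \<tau>" by simp
    from canonical_tree_prefixD[OF \<tau> this] canonical_tree_children[OF \<tau> that(1)] that(2)
    show False by (auto simp: c_def)
  qed
  have pre: "m \<in> A" if "m @ [i] \<in> A" for m i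
    using that
  proof (rule A_cases)
    assume "m @ [i] \<in> \<tau>"
    then show ?thesis by (rule A_old[OF canonical_tree_snocD[OF \<tau>]])
  next
    fix m' j v
    assume *: "m @ [i] = m' @ (c m' + j) # v" "m' \<in> \<tau>" "j \<in> {1..N m'}" "v \<in> tree_of (G (m', j))"
    show ?thesis
    proof (cases v rule: rev_cases)
      case Nil
      then have "m = m'" using *(1) by simp
      then show ?thesis using A_old *(2) by simp
    next
      case (snoc w k)
      then have "m = m' @ (c m' + j) # w" "w \<in> tree_of (G (m', j))"
        using *(1,4) by (simp_all add: tree_of_snoc)
      then show ?thesis using A_new[OF *(2,3)] by simp
    qed
  qed
  have old: "m @ [i] \<in> A \<longleftrightarrow> i \<in> {1..c m + N m}" if m: "m \<in> \<tau>" for m i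
  proof
    assume "m @ [i] \<in> A"
    then show "i \<in> {1..c m + N m}"
    proof (rule A_cases)
      assume "m @ [i] \<in> \<tau>"
      then show ?thesis using canonical_tree_children[OF \<tau> m] by (simp add: c_def)
    next
      fix m' j v
      assume *: "m @ [i] = m' @ (c m' + j) # v" "m' \<in> \<tau>" "j \<in> {1..N m'}"
      show ?thesis
      proof (cases v rule: rev_cases)
        case Nil
        then have "m = m'" "i = c m' + j" using *(1) by simp_all
        then show ?thesis using *(3) by simp
      next
        case (snoc w k)
        then have "m = m' @ (c m' + j) # w" using *(1) by simp
        then show ?thesis using no[OF *(2,3), of w] m by simp
      qed
    qed
  next
    assume i: "i \<in> {1..c m + N m}"
    show "m @ [i] \<in> A"
    proof (cases "i \<le> c m")
      case True
      then have "m @ [i] \<in> \<tau>" using i canonical_tree_children[OF \<tau> m] by (simp add: c_def)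
      then show ?thesis by (rule A_old)
    next
      case False
      then have "i - c m \<in> {1..N m}" "c m + (i - c m) = i" using i by auto
      moreover have "[] \<in> tree_of (G (m, i - c m))" by (simp add: tree_of_def)
      ultimately show ?thesis using A_new[OF m, of "i - c m" "[]"] by simp
    qed
  qed
  have new: "(m @ (c m + j) # v) @ [i] \<in> A \<longleftrightarrow> i \<in> {1..G (m, j) v}"
    if m: "m \<in> \<tau>" "j \<in> {1..N m}" "v \<in> tree_of (G (m, j))" for m j v i
  proof
    assume "(m @ (c m + j) # v) @ [i] \<in> A"
    then show "i \<in> {1..G (m, j) v}"
    proof (rule A_cases)
      assume "(m @ (c m + j) # v) @ [i] \<in> \<tau>"
      then show ?thesis using no[OF m(1,2), of "v @ [i]"] by simp
    next
      fix m' j' v'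
      assume *: "(m @ (c m + j) # v) @ [i] = m' @ (c m' + j') # v'"
        "m' \<in> \<tau>" "j' \<in> {1..N m'}" "v' \<in> tree_of (G (m', j'))"
      then have eq: "m @ (c m + j) # (v @ [i]) = m' @ (c m' + j') # v'" by simp
      then obtain w where
        "m = m' @ w \<and> w @ (c m + j) # (v @ [i]) = (c m' + j') # v' \<or>
         m @ w = m' \<and> (c m + j) # (v @ [i]) = w @ (c m' + j') # v'"
        unfolding append_eq_append_conv2 by blast
      then have "m = m'"
      proof (elim disjE conjE)
        assume w: "m = m' @ w" "w @ (c m + j) # (v @ [i]) = (c m' + j') # v'"
        show "m = m'"
        proof (cases w)
          case (Cons x xs)
          then have "m = m' @ (c m' + j') # xs" using w by simp
          then show ?thesis using no[OF *(2,3), of xs] m(1) by simp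
        qed (use w in simp)
      next
        assume w: "m @ w = m'" "(c m + j) # (v @ [i]) = w @ (c m' + j') # v'"
        show "m = m'"
        proof (cases w)
          case (Cons x xs)
          then have "m' = m @ (c m + j) # xs" using w by simp
          then show ?thesis using no[OF m(1,2), of xs] *(2) by simp
        qed (use w in simp)
      qed
      then have "v' = v @ [i]" "j' = j" using eq by simp_all
      then show ?thesis using *(4) \<open>m = m'\<close> by (simp add: tree_of_snoc)
    qed
  next
    assume "i \<in> {1..G (m, j) v}"
    then have "v @ [i] \<in> tree_of (G (m, j))" using m by (simp add: tree_of_snoc)
    then show "(m @ (c m + j) # v) @ [i] \<in> A" using A_new[OF m(1,2)] by simp
  qed
  have "canonical_tree A"
  proof (rule canonical_treeI)
    show "[] \<in> A" by (rule A_old[OF canonical_tree_Nil[OF \<tau>]])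
  next
    fix m i assume "m @ [i] \<in> A"
    then show "m \<in> A" by (rule pre)
  next
    fix x assume "x \<in> A"
    then show "\<exists>b. \<forall>i. (x @ [i] \<in> A) = (i \<in> {1..b})"
    proof (rule A_cases)
      assume "x \<in> \<tau>"
      then show ?thesis using old by (intro exI[of _ "c x + N x"]) simp
    next
      fix m j v
      assume "x = m @ (c m + j) # v" "m \<in> \<tau>" "j \<in> {1..N m}" "v \<in> tree_of (G (m, j))"
      then show ?thesis using new by (intro exI[of _ "G (m, j) v"]) simp
    qed
  qed
  then show ?thesis by (simp add: A_def)
qed

lemma new_label_Nil [simp]: "new_label \<sigma> t [] = []"
  by (simp add: new_label_def)

lemma length_new_label [simp]: "length (new_label \<sigma> t m) = length m"
  by (simp add: new_label_def)

lemma new_label_snoc: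
  "new_label \<sigma> t (m @ [i]) = new_label \<sigma> t m @ [\<sigma> (m, num_children t m) i]"
  by (simp add: new_label_def nth_append)

lemma space_relabel_space:
  "space relabel_space = {\<sigma>. \<forall>m c. \<sigma> (m, c) permutes {1..c}}"
  by (simp add: relabel_space_def space_PiM space_uniform_count_measure PiE_UNIV_domain Pi_def)

lemma canonical_relabel:
  assumes t: "canonical_tree t" and \<sigma>: "\<sigma> \<in> space relabel_space"
  shows "canonical_tree (relabel \<sigma> t)"
proof -
  have perm: "\<sigma> (m, c) permutes {1..c}" for m c
    using \<sigma> by (simp add: space_relabel_space)
  have inj: "new_label \<sigma> t m = new_label \<sigma> t m' \<Longrightarrow> m = m'" for m m'
  proof (induction m arbitrary: m' rule: rev_induct)
    case Nil
    then show ?case by (cases m' rule: rev_cases) (auto simp: new_label_snoc)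
  next
    case (snoc i m)
    then obtain w k where m': "m' = w @ [k]"
      by (cases m' rule: rev_cases) (auto simp: new_label_snoc)
    have "m = w" "\<sigma> (m, num_children t m) i = \<sigma> (w, num_children t w) k"
      using snoc by (auto simp: m' new_label_snoc)
    then show ?case using permutes_inj[OF perm] by (auto simp: m' inj_def)
  qed
  have children: "new_label \<sigma> t m @ [k] \<in> relabel \<sigma> t \<longleftrightarrow> k \<in> {1..num_children t m}"
    if m: "m \<in> t" for m k
  proof
    assume "new_label \<sigma> t m @ [k] \<in> relabel \<sigma> t"
    then obtain m' where m': "m' \<in> t" "new_label \<sigma> t m' = new_label \<sigma> t m @ [k]"
      by (auto simp: relabel_def)
    then obtain w i where w: "m' = w @ [i]"
      by (cases m' rule: rev_cases) auto
    with m' have "w = m" "k = \<sigma> (m, num_children t m) i"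
      using inj by (auto simp: new_label_snoc)
    then show "k \<in> {1..num_children t m}"
      using m' w canonical_tree_children[OF t m] permutes_in_image[OF perm] by metis
  next
    assume "k \<in> {1..num_children t m}"
    then obtain i where i: "i \<in> {1..num_children t m}" "k = \<sigma> (m, num_children t m) i"
      using permutes_image[OF perm] by (metis imageE)
    then have "m @ [i] \<in> t" using canonical_tree_children[OF t m] by simp
    then have "new_label \<sigma> t (m @ [i]) \<in> relabel \<sigma> t" by (simp add: relabel_def)
    then show "new_label \<sigma> t m @ [k] \<in> relabel \<sigma> t" by (simp add: new_label_snoc i)
  qed
  have pre: "x \<in> relabel \<sigma> t" if "x @ [k] \<in> relabel \<sigma> t" for x k
  proof -
    from that obtain m' where m': "m' \<in> t" "new_label \<sigma> t m' = x @ [k]"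
      by (auto simp: relabel_def)
    then obtain w i where w: "m' = w @ [i]"
      by (cases m' rule: rev_cases) auto
    then have "w \<in> t" "x = new_label \<sigma> t w"
      using m' canonical_tree_snocD[OF t, of w i] by (simp_all add: new_label_snoc)
    then show ?thesis by (simp add: relabel_def)
  qed
  have "new_label \<sigma> t [] \<in> relabel \<sigma> t"
    unfolding relabel_def by (rule imageI[OF canonical_tree_Nil[OF t]])
  then show ?thesis
  proof (intro canonical_treeI)
    fix x assume "x \<in> relabel \<sigma> t"
    then obtain m where "m \<in> t" "x = new_label \<sigma> t m" by (auto simp: relabel_def)
    then show "\<exists>c. \<forall>i. x @ [i] \<in> relabel \<sigma> t \<longleftrightarrow> i \<in> {1..c}" using children by blast
    next
    fix x k assume "x @ [k] \<in> relabel \<sigma> t"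
    then show "x \<in> relabel \<sigma> t" by (rule pre)
  qed simp
qed

lemma prune_in_trees_upto:
  assumes "canonical_tree t" shows "prune n t \<in> trees_upto n"
proof -
  have "\<exists>c. \<forall>i. m @ [i] \<in> prune n t \<longleftrightarrow> i \<in> {1..c}" if "m \<in> prune n t" for m
  proof (cases "length m < n")
    case True
    then have iff: "m @ [i] \<in> prune n t \<longleftrightarrow> m @ [i] \<in> t" for i by (simp add: prune_def)
    have "m \<in> t" using that by (simp add: prune_def)
    then show ?thesis unfolding iff by (rule canonical_tree_finite_children[OF assms])
  next
    case False
    then show ?thesis by (intro exI[of _ 0]) (auto simp: prune_def)
  qed
  moreover have "[] \<in> prune n t" using canonical_tree_Nil[OF assms] by (simp add: prune_def)
  moreover have "m \<in> prune n t" if "m @ [i] \<in> prune n t" for m i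
    using that canonical_tree_snocD[OF assms, of m i] by (simp add: prune_def)
  ultimately have "canonical_tree (prune n t)" by (intro canonical_treeI)
  then show ?thesis by (simp add: trees_upto_def prune_def)
qed

lemma finite_trees_upto: "t \<in> trees_upto n \<Longrightarrow> finite t"
proof -
  assume t: "t \<in> trees_upto n"
  then have can: "canonical_tree t" by (simp add: trees_upto_def)
  have "finite {m \<in> t. length m = k}" for k
  proof (induction k)
    case (Suc k)
    have "{m \<in> t. length m = Suc k} \<subseteq>
        (\<Union>m\<in>{m \<in> t. length m = k}. (\<lambda>i. m @ [i]) ` {1..num_children t m})"
    proof
      fix x assume x: "x \<in> {m \<in> t. length m = Suc k}"
      then obtain m i where mi: "x = m @ [i]" by (cases x rule: rev_cases) auto
      then have "m \<in> t" using x canonical_tree_snocD[OF can, of m i] by simp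
      then show "x \<in> (\<Union>m\<in>{m \<in> t. length m = k}. (\<lambda>i. m @ [i]) ` {1..num_children t m})"
        using x mi canonical_tree_children[OF can] by auto
    qed
    then show ?case using Suc by (meson finite_UN_I finite_atLeastAtMost finite_imageI finite_subset)
  qed auto
  then have "finite (\<Union>k\<le>n. {m \<in> t. length m = k})" by auto
  moreover have "t = (\<Union>k\<le>n. {m \<in> t. length m = k})" using t by (auto simp: trees_upto_def)
  ultimately show ?thesis by simp
qed

lemma countable_trees_upto: "countable (trees_upto n)"
proof (rule countable_subset)
  show "trees_upto n \<subseteq> {A. finite A \<and> A \<subseteq> UNIV}" using finite_trees_upto by auto
qed (rule countable_Collect_finite_subset, simp)

lemma prob_space_gw_space: "prob_space (gw_space \<mu>)"
  unfolding gw_space_def by (intro prob_space_PiM measure_pmf.prob_space_axioms)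

lemma prob_space_relabel_space: "prob_space relabel_space"
  unfolding relabel_space_def
proof (rule prob_space_PiM)
  fix x :: "label \<times> nat"
  obtain m c where x: "x = (m, c)" by (cases x)
  have "id \<in> {\<pi>. \<pi> permutes {1..c}}" using permutes_id by blast
  then have "prob_space (uniform_count_measure {\<pi>. \<pi> permutes {1..c}})"
    by (intro prob_space_uniform_count_measure finite_permutations) (simp, blast)
  then show "prob_space (case x of (m, c) \<Rightarrow> uniform_count_measure {\<pi>. \<pi> permutes {1..c}})"
    by (simp add: x)
qed

lemma prob_space_aug_space: "prob_space (aug_space lam s)"
  unfolding aug_space_def
  by (intro prob_space_pair prob_space_PiM prob_space_gw_space measure_pmf.prob_space_axioms)

lemma prob_space_null_space: "prob_space (null_space lam)"
  unfolding null_space_def by (intro prob_space_pair prob_space_gw_space)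

lemma prob_space_planted_space: "prob_space (planted_space lam s)"
  unfolding planted_space_def
  by (intro prob_space_pair prob_space_gw_space prob_space_aug_space prob_space_relabel_space)

lemma measurable_prune:
  assumes mem: "\<And>m. Measurable.pred M (\<lambda>\<omega>. m \<in> f \<omega>)"
    and can: "\<And>\<omega>. \<omega> \<in> space M \<Longrightarrow> canonical_tree (f \<omega>)"
  shows "(\<lambda>\<omega>. prune n (f \<omega>)) \<in> M \<rightarrow>\<^sub>M count_space (trees_upto n)"
  unfolding measurable_count_space_eq_countable[OF countable_trees_upto]
proof (intro conjI ballI)
  fix t assume "t \<in> trees_upto n"
  note mem[measurable]
  have "(\<lambda>\<omega>. prune n (f \<omega>)) -` {t} \<inter> space M =
      {\<omega> \<in> space M. \<forall>m. (m \<in> f \<omega> \<and> length m \<le> n) = (m \<in> t)}"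
    by (auto simp: prune_def)
  also have "\<dots> \<in> sets M" by measurable
  finally show "(\<lambda>\<omega>. prune n (f \<omega>)) -` {t} \<inter> space M \<in> sets M" .
qed (use can prune_in_trees_upto in auto)

lemma measurable_offspring:
  assumes "c \<in> M \<rightarrow>\<^sub>M PiM UNIV (\<lambda>_. measure_pmf p)"
  shows "(\<lambda>\<omega>. c \<omega> m) \<in> M \<rightarrow>\<^sub>M count_space UNIV"
proof -
  have "(\<lambda>\<omega>. c \<omega> m) \<in> M \<rightarrow>\<^sub>M measure_pmf p"
    by (rule measurable_compose[OF assms measurable_component_singleton]) simp
  then show ?thesis by simp
qed

lemma measurable_mem_tree_of:
  assumes "c \<in> M \<rightarrow>\<^sub>M gw_space \<mu>"
  shows "Measurable.pred M (\<lambda>\<omega>. m \<in> tree_of (c \<omega>))"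
proof -
  note measurable_offspring[OF assms[unfolded gw_space_def], measurable]
  show ?thesis unfolding tree_of_def mem_Collect_eq atLeastAtMost_iff by measurable
qed

lemma measurable_num_children:
  assumes mem: "\<And>m. Measurable.pred M (\<lambda>\<omega>. m \<in> t \<omega>)"
  shows "(\<lambda>\<omega>. num_children (t \<omega>) m) \<in> M \<rightarrow>\<^sub>M count_space UNIV"
proof -
  note mem[measurable]
  show ?thesis unfolding num_children_def by (rule measurable_card) simp
qed

lemma measurable_mem_augment:
  assumes mem: "\<And>m. Measurable.pred M (\<lambda>\<omega>. m \<in> \<tau> \<omega>)"
    and a: "a \<in> M \<rightarrow>\<^sub>M aug_space lam s"
  shows "Measurable.pred M (\<lambda>\<omega>. m \<in> augment (a \<omega>) (\<tau> \<omega>))"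
proof -
  have "(\<lambda>\<omega>. fst (a \<omega>)) \<in> M \<rightarrow>\<^sub>M PiM UNIV (\<lambda>_. measure_pmf (poisson (lam * (1 - s))))"
    by (rule measurable_compose[OF a[unfolded aug_space_def] measurable_fst])
  note measurable_offspring[OF this, measurable]
  have "(\<lambda>\<omega>. snd (a \<omega>)) \<in> M \<rightarrow>\<^sub>M PiM UNIV (\<lambda>_. gw_space lam)"
    by (rule measurable_compose[OF a[unfolded aug_space_def] measurable_snd])
  then have "(\<lambda>\<omega>. snd (a \<omega>) x) \<in> M \<rightarrow>\<^sub>M gw_space lam" for x
    by (rule measurable_compose[OF _ measurable_component_singleton]) simp
  note measurable_mem_tree_of[OF this, measurable]
  note mem[measurable] measurable_num_children[OF mem, measurable]
  have "(\<lambda>\<omega>. m \<in> augment (a \<omega>) (\<tau> \<omega>)) = (\<lambda>\<omega>. m \<in> \<tau> \<omega> \<or>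
     (\<exists>u j v. m = u @ (num_children (\<tau> \<omega>) u + j) # v \<and>
        u \<in> \<tau> \<omega> \<and> (1 \<le> j \<and> j \<le> fst (a \<omega>) u) \<and> v \<in> tree_of (snd (a \<omega>) (u, j))))"
    (is "_ = ?P")
  proof
    fix \<omega> show "(m \<in> augment (a \<omega>) (\<tau> \<omega>)) = ?P \<omega>"
      using augment_iff[of m "fst (a \<omega>)" "snd (a \<omega>)" "\<tau> \<omega>"] by simp
  qed
  also have "Measurable.pred M \<dots>"
    by measurable
  finally show ?thesis .
qed

lemma measurable_mem_relabel:
  assumes mem: "\<And>m. Measurable.pred M (\<lambda>\<omega>. m \<in> t \<omega>)"
    and \<sigma>: "\<sigma> \<in> M \<rightarrow>\<^sub>M relabel_space"
  shows "Measurable.pred M (\<lambda>\<omega>. m \<in> relabel (\<sigma> \<omega>) (t \<omega>))"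
proof -
  have perm: "(\<lambda>\<omega>. \<sigma> \<omega> (u, c) i) \<in> M \<rightarrow>\<^sub>M count_space UNIV" for u c i
  proof -
    have "(\<lambda>\<omega>. \<sigma> \<omega> (u, c)) \<in> M \<rightarrow>\<^sub>M uniform_count_measure {\<pi>. \<pi> permutes {1..c}}"
      using measurable_compose[OF \<sigma>[unfolded relabel_space_def]
          measurable_component_singleton[of "(u, c)"]] by simp
    then have "(\<lambda>\<omega>. \<sigma> \<omega> (u, c)) \<in> M \<rightarrow>\<^sub>M count_space {\<pi>. \<pi> permutes {1..c}}"
      by (subst (asm) measurable_cong_sets[OF refl sets_uniform_count_measure_count_space])
    then show ?thesis
      by (rule measurable_compose[where g = "\<lambda>\<pi>. \<pi> i"]) simp
  qed
  have "(\<lambda>\<omega>. \<sigma> \<omega> (u, num_children (t \<omega>) u) i) \<in> M \<rightarrow>\<^sub>M count_space UNIV" for u i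
    by (rule measurable_compose_countable[OF perm measurable_num_children[OF mem]])
  note this[measurable]
  have label: "(\<lambda>\<omega>. new_label (\<sigma> \<omega>) (t \<omega>) v) \<in> M \<rightarrow>\<^sub>M count_space UNIV" for v
  proof (induction v rule: rev_induct)
    case (snoc i v)
    note snoc[measurable]
    show ?case unfolding new_label_snoc by measurable
  qed simp
  note label[measurable] mem[measurable]
  have "(\<lambda>\<omega>. m \<in> relabel (\<sigma> \<omega>) (t \<omega>)) =
      (\<lambda>\<omega>. \<exists>v. v \<in> t \<omega> \<and> new_label (\<sigma> \<omega>) (t \<omega>) v = m)"
    by (auto simp: relabel_def fun_eq_iff)
  also have "Measurable.pred M \<dots>" by measurable
  finally show ?thesis .
qed

lemma measurable_prune_pair:
  assumes "(\<lambda>\<omega>. prune n (fst (f \<omega>))) \<in> M \<rightarrow>\<^sub>M count_space (trees_upto n)"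
    and "(\<lambda>\<omega>. prune n (snd (f \<omega>))) \<in> M \<rightarrow>\<^sub>M count_space (trees_upto n)"
  shows "(\<lambda>\<omega>. map_prod (prune n) (prune n) (f \<omega>))
    \<in> M \<rightarrow>\<^sub>M count_space (trees_upto n \<times> trees_upto n)"
proof -
  have "(\<lambda>\<omega>. (prune n (fst (f \<omega>)), prune n (snd (f \<omega>))))
      \<in> M \<rightarrow>\<^sub>M count_space (trees_upto n) \<Otimes>\<^sub>M count_space (trees_upto n)"
    using assms by (rule measurable_Pair)
  then show ?thesis
    by (simp add: pair_measure_countable countable_trees_upto map_prod_def case_prod_beta)
qed

lemma measurable_null_trees:
  "(\<lambda>\<omega>. map_prod (prune n) (prune n) (null_trees \<omega>))
    \<in> null_space lam \<rightarrow>\<^sub>M count_space (trees_upto n \<times> trees_upto n)"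
proof (rule measurable_prune_pair)
  have fst_eq: "fst (null_trees \<omega>) = tree_of (fst \<omega>)"
    and snd_eq: "snd (null_trees \<omega>) = tree_of (snd \<omega>)" for \<omega>
    by (simp_all add: null_trees_def split: prod.split)
  have m: "fst \<in> null_space lam \<rightarrow>\<^sub>M gw_space lam" "snd \<in> null_space lam \<rightarrow>\<^sub>M gw_space lam"
    unfolding null_space_def by (rule measurable_fst measurable_snd)+
  show "(\<lambda>\<omega>. prune n (fst (null_trees \<omega>))) \<in> null_space lam \<rightarrow>\<^sub>M count_space (trees_upto n)"
    unfolding fst_eq by (rule measurable_prune[OF measurable_mem_tree_of[OF m(1)] canonical_tree_of])
  show "(\<lambda>\<omega>. prune n (snd (null_trees \<omega>))) \<in> null_space lam \<rightarrow>\<^sub>M count_space (trees_upto n)"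
    unfolding snd_eq by (rule measurable_prune[OF measurable_mem_tree_of[OF m(2)] canonical_tree_of])
qed

lemma measurable_planted_trees:
  "(\<lambda>\<omega>. map_prod (prune n) (prune n) (planted_trees \<omega>))
    \<in> planted_space lam s \<rightarrow>\<^sub>M count_space (trees_upto n \<times> trees_upto n)"
proof (rule measurable_prune_pair)
  let ?M = "planted_space lam s"
  have fst_eq: "fst (planted_trees \<omega>) =
      relabel (snd (fst (snd \<omega>))) (augment (fst (fst (snd \<omega>))) (tree_of (fst \<omega>)))"
    and snd_eq: "snd (planted_trees \<omega>) =
      relabel (snd (snd (snd \<omega>))) (augment (fst (snd (snd \<omega>))) (tree_of (fst \<omega>)))" for \<omega>
    unfolding planted_trees_def case_prod_beta fst_conv snd_conv by (rule refl)+
  have c: "fst \<in> ?M \<rightarrow>\<^sub>M gw_space (lam * s)"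
    unfolding planted_space_def by (rule measurable_fst)
  have 1: "(\<lambda>\<omega>. fst (snd \<omega>)) \<in> ?M \<rightarrow>\<^sub>M aug_space lam s \<Otimes>\<^sub>M relabel_space"
    and 2: "(\<lambda>\<omega>. snd (snd \<omega>)) \<in> ?M \<rightarrow>\<^sub>M aug_space lam s \<Otimes>\<^sub>M relabel_space"
    unfolding planted_space_def
    by (rule measurable_compose[OF measurable_snd measurable_fst]
        measurable_compose[OF measurable_snd measurable_snd])+
  note a = measurable_compose[OF 1 measurable_fst] and \<sigma> = measurable_compose[OF 1 measurable_snd]
  note a' = measurable_compose[OF 2 measurable_fst] and \<sigma>' = measurable_compose[OF 2 measurable_snd]
  note aug = measurable_mem_augment[OF measurable_mem_tree_of[OF c]]
  note can = canonical_relabel[OF canonical_augment[OF canonical_tree_of]]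
  show "(\<lambda>\<omega>. prune n (fst (planted_trees \<omega>))) \<in> ?M \<rightarrow>\<^sub>M count_space (trees_upto n)"
    unfolding fst_eq
    by (rule measurable_prune[OF measurable_mem_relabel[OF aug[OF a] \<sigma>]
          can[OF measurable_space[OF \<sigma>]]])
  show "(\<lambda>\<omega>. prune n (snd (planted_trees \<omega>))) \<in> ?M \<rightarrow>\<^sub>M count_space (trees_upto n)"
    unfolding snd_eq
    by (rule measurable_prune[OF measurable_mem_relabel[OF aug[OF a'] \<sigma>']
          can[OF measurable_space[OF \<sigma>']]])
qed

lemma prob_space_null_law: "prob_space (null_law lam n)"
  unfolding null_law_def
  by (rule prob_space.prob_space_distr[OF prob_space_null_space measurable_null_trees])

lemma prob_space_planted_law: "prob_space (planted_law lam s n)"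
  unfolding planted_law_def
  by (rule prob_space.prob_space_distr[OF prob_space_planted_space measurable_planted_trees])

end

theory Submission
  imports Defs "HOL-Real_Asymp.Real_Asymp"
begin

text \<open>
  Write \<open>\<epsilon> = \<lambda> (1 - s)\<close>; the hypothesis forces \<open>\<epsilon>\<close> to be small when \<open>\<lambda> s\<close> is large. Let \<open>k\<close> be
  the integer part of \<open>\<lambda> / 4\<close>. The test declares two trees correlated at level \<open>n + 1\<close> when their
  roots have at most \<open>9 k\<close> children each and some \<open>k\<close> children of one root can be matched injectively
  with children of the other root such that matched subtrees are correlated at level \<open>n\<close>. At level 0,
  the first generations must have equal size, between \<open>2 k\<close> and \<open>9 k\<close>, and the sizes of the second
  generations may differ by at most \<open>K\<close>, a small multiple of \<open>sqrt k\<close>.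

  For independent trees, anticoncentration of the Poisson law bounds the probability at level 0 by
  \<open>O(K / k powr (3/2))\<close>, hence by a small multiple of \<open>1 / k\<close>. A union bound over the at most
  \<open>2 ^ (9 k) * (9 k) ^ k\<close> matchings turns a bound \<open>q\<close> at one level into \<open>(2 ^ 9 * 9 k * q) ^ k\<close> at
  the next, so the probabilities tend to zero.

  For correlated trees, level 0 fails with probability at most \<open>1 / 16\<close> because the new nodes in the
  second generation are Poisson in number with variance \<open>O(k \<epsilon>)\<close>, far below \<open>K\<^sup>2\<close>. If the root
  receives no new children and has at least \<open>2 k\<close> old ones, the next level can only fail when \<open>k\<close>
  of the first \<open>2 k\<close> old children fail, which has probability at most \<open>4 ^ k / 16 ^ k\<close>; so the bound
  \<open>1 / 16\<close> is preserved at every level.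
\<close>

subsection \<open>Poisson laws\<close>

text \<open>Since \<open>0 ^ 0 = 1\<close>, one formula also covers the rate 0, which occurs for the
  augmentation when \<open>s = 1\<close> and for empty sums of offspring numbers.\<close>

lemma pmf_poisson_rate:
  assumes "0 \<le> \<mu>" shows "pmf (poisson \<mu>) x = \<mu> ^ x / fact x * exp (- \<mu>)"
  using assms by (cases "\<mu> = 0"; cases x) (auto simp: poisson_def)

text \<open>Up to the factor \<open>exp (- (a + b)) / fact x\<close> the left side is the binomial
  expansion of \<open>(a + b) ^ x\<close>.\<close>

lemma pmf_poisson_convolution:
  assumes "0 \<le> a" "0 \<le> b"
  shows "(\<Sum>z\<le>x. pmf (poisson a) z * pmf (poisson b) (x - z)) = pmf (poisson (a + b)) x"
proof -
  have "(\<Sum>z\<le>x. pmf (poisson a) z * pmf (poisson b) (x - z)) =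
      (\<Sum>z\<le>x. real (x choose z) * a ^ z * b ^ (x - z) * (exp (- (a + b)) / fact x))"
  proof (rule sum.cong)
    fix z assume "z \<in> {..x}"
    then have "real (x choose z) = fact x / (fact z * fact (x - z))"
      by (simp add: binomial_fact)
    then show "pmf (poisson a) z * pmf (poisson b) (x - z) =
        real (x choose z) * a ^ z * b ^ (x - z) * (exp (- (a + b)) / fact x)"
      using assms by (simp add: pmf_poisson_rate field_simps exp_diff exp_minus)
  qed simp
  also have "\<dots> = (a + b) ^ x * (exp (- (a + b)) / fact x)"
    by (simp only: binomial_ring sum_distrib_right)
  finally show ?thesis using assms by (simp add: pmf_poisson_rate)
qed

lemma pmf_poisson_Suc:
  assumes "0 \<le> \<mu>" shows "pmf (poisson \<mu>) (Suc x) = pmf (poisson \<mu>) x * (\<mu> / Suc x)"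
  using assms by (simp add: pmf_poisson_rate field_simps)

text \<open>Anticoncentration. From a point \<open>x \<le> \<mu>\<close> the mass drops by a factor
  of at most 3 over the next \<open>M\<close> points, where \<open>M\<close> is about
  \<open>sqrt \<mu>\<close>. These \<open>M + 1\<close> masses add up to at most 1, which bounds the
  first of them. Beyond the mean the masses decrease, so the bound at the integer part of
  \<open>\<mu>\<close> carries over.\<close>

lemma pmf_poisson_le:
  assumes \<mu>: "0 < \<mu>" shows "pmf (poisson \<mu>) x \<le> 3 / sqrt \<mu>"
proof -
  define p where "p = pmf (poisson \<mu>)"
  have p_Suc: "p (Suc x) = p x * (\<mu> / Suc x)" for x
    unfolding p_def using \<mu> by (intro pmf_poisson_Suc) simp
  have p_nonneg: "0 \<le> p x" for x by (simp add: p_def)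
  \<comment> \<open>The window length must satisfy \<open>M * M \<le> \<mu>\<close> for the factor 3
    and \<open>sqrt \<mu> \<le> M + 1\<close> for the final count.\<close>
  define M where "M = nat \<lfloor>sqrt \<mu>\<rfloor>"
  have M: "real M \<le> sqrt \<mu>" "sqrt \<mu> \<le> real (Suc M)"
    using \<mu> unfolding M_def by (auto simp: of_nat_floor) linarith
  have small: "p x \<le> 3 / sqrt \<mu>" if x: "real x \<le> \<mu>" for x
  proof -
    \<comment> \<open>Each ratio of consecutive masses is \<open>\<mu> / (x + i + 1)\<close>, and
      \<open>x + i + 1 \<le> \<mu> + M\<close> inside the window.\<close>
    have step: "p x * (\<mu> / (\<mu> + M)) ^ i \<le> p (x + i)" if "i \<le> M" for i
      using that
    proof (induction i)
      case (Suc i)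
      have "p x * (\<mu> / (\<mu> + M)) ^ Suc i = p x * (\<mu> / (\<mu> + M)) ^ i * (\<mu> / (\<mu> + M))" by simp
      also have "\<dots> \<le> p (x + i) * (\<mu> / Suc (x + i))"
        using Suc \<mu> x p_nonneg[of x] p_nonneg[of "x + i"]
        by (intro mult_mono divide_left_mono) auto
      also have "\<dots> = p (x + Suc i)" by (simp add: p_Suc)
      finally show ?case .
    qed simp
    have "(1 + M / \<mu>) ^ M \<le> exp (M / \<mu>) ^ M"
      using \<mu> by (intro power_mono exp_ge_add_one_self) auto
    also have "\<dots> = exp (real M * (M / \<mu>))"
      by (rule exp_of_nat_mult[symmetric])
    also have "real M * (M / \<mu>) \<le> 1"
    proof -
      have "real M * real M \<le> sqrt \<mu> * sqrt \<mu>" using M by (intro mult_mono) (use \<mu> in auto)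
      then show ?thesis using \<mu> by simp
    qed
    also have "exp (1::real) \<le> 3" by (rule exp_le)
    finally have pow: "(1 + M / \<mu>) ^ M \<le> 3" by simp
    have low: "p x / 3 \<le> p (x + i)" if "i \<le> M" for i
    proof -
      have "(1 + M / \<mu>) ^ i \<le> (1 + M / \<mu>) ^ M"
        using that \<mu> by (intro power_increasing) auto
      with pow have "(1 + M / \<mu>) ^ i \<le> 3" by simp
      then have "1 / 3 \<le> 1 / (1 + M / \<mu>) ^ i"
        using \<mu> by (intro divide_left_mono mult_pos_pos zero_less_power add_pos_nonneg) auto
      also have "1 / (1 + M / \<mu>) ^ i = (\<mu> / (\<mu> + M)) ^ i"
        using \<mu> by (simp add: field_simps flip: power_mult_distrib)
      finally have "p x * (1 / 3) \<le> p x * (\<mu> / (\<mu> + M)) ^ i"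
        by (intro mult_left_mono p_nonneg)
      with step[OF that] show ?thesis by simp
    qed
    have "sqrt \<mu> * (p x / 3) \<le> real (Suc M) * (p x / 3)"
      using M p_nonneg by (intro mult_right_mono) auto
    also have "\<dots> = (\<Sum>i\<le>M. p x / 3)" by simp
    also have "\<dots> \<le> (\<Sum>i\<le>M. p (x + i))" using low by (intro sum_mono) auto
    also have "\<dots> = sum p ((+) x ` {..M})" by (subst sum.reindex) auto
    also have "\<dots> = measure_pmf.prob (poisson \<mu>) ((+) x ` {..M})"
      unfolding p_def by (rule measure_measure_pmf_finite[symmetric]) simp
    also have "\<dots> \<le> 1" by simp
    finally show ?thesis using \<mu> by (simp add: field_simps)
  qed
  have "p (nat \<lfloor>\<mu>\<rfloor> + i) \<le> p (nat \<lfloor>\<mu>\<rfloor>)" for i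
  proof (induction i)
    case (Suc i)
    have "\<mu> \<le> real (Suc (nat \<lfloor>\<mu>\<rfloor> + i))" using \<mu> by simp linarith
    then have "\<mu> / Suc (nat \<lfloor>\<mu>\<rfloor> + i) \<le> 1" by simp
    then have "p (nat \<lfloor>\<mu>\<rfloor> + Suc i) \<le> p (nat \<lfloor>\<mu>\<rfloor> + i)"
      unfolding add_Suc_right p_Suc by (rule mult_left_le[OF _ p_nonneg])
    then show ?case using Suc by simp
  qed simp
  note large = this[of "x - nat \<lfloor>\<mu>\<rfloor>"]
  show ?thesis
  proof (cases "real x \<le> \<mu>")
    case True then show ?thesis using small p_def by simp
  next
    case False
    then have "nat \<lfloor>\<mu>\<rfloor> \<le> x" by linarith
    then have "p x \<le> p (nat \<lfloor>\<mu>\<rfloor>)" using large by simp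
    also have "\<dots> \<le> 3 / sqrt \<mu>" using \<mu> by (intro small) (simp add: of_nat_floor)
    finally show ?thesis by (simp add: p_def)
  qed
qed

text \<open>The recursion \<open>p (x + 1) * (x + 1) = \<mu> * p x\<close> turns each factorial
  moment into the next one by an index shift. The variance is then the combination
  \<open>x * (x - 1) + (1 - 2 * \<mu>) * x\<close> plus the square of \<open>\<mu>\<close>.\<close>

lemma poisson_variance_sums:
  assumes "0 \<le> \<mu>" shows "(\<lambda>x. pmf (poisson \<mu>) x * (real x - \<mu>)\<^sup>2) sums \<mu>"
proof -
  define p where "p = pmf (poisson \<mu>)"
  have p0: "p sums 1"
  proof -
    have "(\<lambda>x. \<mu> ^ x /\<^sub>R fact x * exp (- \<mu>)) sums (exp \<mu> * exp (- \<mu>))"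
      by (intro sums_mult2 exp_converges)
    moreover have "p = (\<lambda>x. \<mu> ^ x /\<^sub>R fact x * exp (- \<mu>))"
      using assms by (auto simp: p_def pmf_poisson_rate divide_inverse mult_ac)
    ultimately show ?thesis by (simp flip: exp_add)
  qed
  have p_Suc: "p (Suc x) * (1 + real x) = \<mu> * p x" for x
    using pmf_poisson_Suc[OF assms, of x] by (simp add: p_def)
  have "(\<lambda>x. p (Suc x) * real (Suc x)) sums (\<mu> * 1)"
    using sums_mult[OF p0, of \<mu>] by (simp add: p_Suc)
  from sums_Suc[OF this] have p1: "(\<lambda>x. p x * real x) sums \<mu>" by simp
  have eq: "p (Suc x) * (real (Suc x) * real x) = \<mu> * (p x * real x)" for x
    using p_Suc[of x] by (metis mult.assoc of_nat_Suc)
  have "(\<lambda>x. p (Suc x) * (real (Suc x) * (real (Suc x) - 1))) sums (\<mu> * \<mu>)"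
    using sums_mult[OF p1, of \<mu>] by (simp only: eq[symmetric]) simp
  from sums_Suc[OF this] have p2: "(\<lambda>x. p x * (real x * (real x - 1))) sums (\<mu> * \<mu>)" by simp
  have "(\<lambda>x. p x * (real x * (real x - 1)) + (1 - 2 * \<mu>) * (p x * real x) + \<mu>\<^sup>2 * p x)
      sums (\<mu> * \<mu> + (1 - 2 * \<mu>) * \<mu> + \<mu>\<^sup>2 * 1)"
    by (intro sums_add sums_mult p0 p1 p2)
  then show ?thesis
    by (simp add: p_def power2_eq_square algebra_simps)
qed

text \<open>Markov's inequality for the squared deviation, carried out with nonnegative integrals so
  that integrability never has to be discussed.\<close>

lemma poisson_Chebyshev:
  assumes \<mu>: "0 \<le> \<mu>" and a: "0 < a"
  shows "measure_pmf.prob (poisson \<mu>) {x. a \<le> \<bar>real x - \<mu>\<bar>} \<le> \<mu> / a\<^sup>2"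
proof -
  let ?A = "{x. a \<le> \<bar>real x - \<mu>\<bar>}"
  have "ennreal (a\<^sup>2) * emeasure (poisson \<mu>) ?A = (\<integral>\<^sup>+ x. ennreal (a\<^sup>2) * indicator ?A x \<partial>poisson \<mu>)"
    by (simp add: nn_integral_cmult_indicator)
  also have "\<dots> \<le> (\<integral>\<^sup>+ x. ennreal ((real x - \<mu>)\<^sup>2) \<partial>poisson \<mu>)"
  proof (intro nn_integral_mono)
    fix x
    have "a\<^sup>2 \<le> (real x - \<mu>)\<^sup>2" if "a \<le> \<bar>real x - \<mu>\<bar>"
      using that a by (metis abs_le_square_iff abs_of_pos)
    then show "ennreal (a\<^sup>2) * indicator ?A x \<le> ennreal ((real x - \<mu>)\<^sup>2)"
      by (auto simp: indicator_def intro: ennreal_leI)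
  qed
  also have "\<dots> = (\<Sum>x. ennreal (pmf (poisson \<mu>) x * (real x - \<mu>)\<^sup>2))"
    by (simp add: nn_integral_measure_pmf nn_integral_count_space_nat ennreal_mult)
  also have "\<dots> = ennreal \<mu>"
    using poisson_variance_sums[OF \<mu>] by (intro suminf_ennreal_eq) auto
  finally have "a\<^sup>2 * measure_pmf.prob (poisson \<mu>) ?A \<le> \<mu>"
    using \<mu> by (simp add: measure_pmf.emeasure_eq_measure ennreal_mult[symmetric])
  then show ?thesis using a by (simp add: field_simps)
qed

subsection \<open>The recursive matching relation\<close>

definition gen_size :: "nat \<Rightarrow> tree \<Rightarrow> nat" where
  "gen_size l t = card {m \<in> t. length m = l}"

definition subtree :: "tree \<Rightarrow> nat \<Rightarrow> tree" where
  "subtree t i = {v. i # v \<in> t}"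

text \<open>The cap \<open>9 * k\<close> on both degrees limits the number of matchings in the later
  union bound. The base case reads two generations, so level \<open>n\<close> depends on depth
  \<open>n + 2\<close> only. The condition is existential in \<open>I\<close> and \<open>f\<close>,
  hence insensitive to the order of children.\<close>

fun corr :: "nat \<Rightarrow> nat \<Rightarrow> nat \<Rightarrow> tree \<Rightarrow> tree \<Rightarrow> bool" where
  "corr k K 0 t t' \<longleftrightarrow> gen_size (Suc 0) t = gen_size (Suc 0) t' \<and> gen_size (Suc 0) t \<in> {2 * k..9 * k} \<and>
     \<bar>int (gen_size 2 t) - int (gen_size 2 t')\<bar> \<le> int K"
| "corr k K (Suc n) t t' \<longleftrightarrow> gen_size (Suc 0) t \<le> 9 * k \<and> gen_size (Suc 0) t' \<le> 9 * k \<and>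
     (\<exists>I f. card I = k \<and> inj_on f I \<and>
        (\<forall>i\<in>I. [i] \<in> t \<and> [f i] \<in> t' \<and> corr k K n (subtree t i) (subtree t' (f i))))"

lemma subtree_prune: "subtree (prune (Suc n) t) i = prune n (subtree t i)"
  by (auto simp: subtree_def prune_def)

lemma gen_size_prune: "l \<le> n \<Longrightarrow> gen_size l (prune n t) = gen_size l t"
  unfolding gen_size_def prune_def by (rule arg_cong[of _ _ card]) auto

text \<open>This makes \<open>corr\<close> at level \<open>n\<close> a statistic of the trees pruned
  at depth \<open>n + 2\<close>; it serves both for measurability and for defining the test.\<close>

lemma corr_prune:
  "corr k K n (prune (Suc (Suc n)) t) (prune (Suc (Suc n)) t') = corr k K n t t'"
proof (induction n arbitrary: t t')
  case 0
  show ?case by (simp add: gen_size_prune)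
next
  case (Suc n)
  have "[i] \<in> prune (Suc m) t \<longleftrightarrow> [i] \<in> t" for i t m by (simp add: prune_def)
  then show ?case by (simp only: corr.simps subtree_prune Suc gen_size_prune)
qed

section \<open>Generation sizes and subtrees of canonical trees\<close>

lemma gen_size_1: "gen_size (Suc 0) t = card {i. [i] \<in> t}"
proof -
  have "{m \<in> t. length m = 1} = (\<lambda>i. [i]) ` {i. [i] \<in> t}"
    by (auto simp: length_Suc_conv)
  then show ?thesis by (simp add: gen_size_def card_image inj_on_def)
qed

lemma finite_children:
  assumes "canonical_tree t" "m \<in> t" shows "finite {i. m @ [i] \<in> t}"
  using canonical_tree_children[OF assms] by simp

lemma canonical_subtree:
  assumes "canonical_tree t" "[i] \<in> t" shows "canonical_tree (subtree t i)"
proof (rule canonical_treeI)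
  fix m assume "m \<in> subtree t i"
  then have "i # m \<in> t" by (simp add: subtree_def)
  from canonical_tree_finite_children[OF assms(1) this]
  show "\<exists>c. \<forall>j. m @ [j] \<in> subtree t i \<longleftrightarrow> j \<in> {1..c}" by (simp add: subtree_def)
next
  fix m j assume "m @ [j] \<in> subtree t i"
  then show "m \<in> subtree t i"
    using canonical_tree_snocD[OF assms(1), of "i # m" j] by (simp add: subtree_def)
qed (use assms in \<open>simp add: subtree_def\<close>)

text \<open>Nodes of depth 2 are sorted by their parent. Canonicity supplies the parent and the
  finiteness that \<open>card\<close> requires.\<close>

lemma gen_size_2:
  assumes t: "canonical_tree t"
  shows "gen_size 2 t = (\<Sum>i\<in>{i. [i] \<in> t}. gen_size (Suc 0) (subtree t i))"
proof -
  have "{m \<in> t. length m = 2} = (\<Union>i\<in>{i. [i] \<in> t}. (\<lambda>j. [i, j]) ` {j. [i, j] \<in> t})"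
  proof (intro set_eqI iffI)
    fix m assume m: "m \<in> {m \<in> t. length m = 2}"
    then obtain i j where ij: "m = [i, j]" by (auto simp: length_Suc_conv numeral_2_eq_2)
    then have "[i] \<in> t" using m canonical_tree_snocD[OF t, of "[i]" j] by simp
    then show "m \<in> (\<Union>i\<in>{i. [i] \<in> t}. (\<lambda>j. [i, j]) ` {j. [i, j] \<in> t})"
      using m ij by auto
  qed auto
  also have "card \<dots> = (\<Sum>i\<in>{i. [i] \<in> t}. card ((\<lambda>j. [i, j]) ` {j. [i, j] \<in> t}))"
  proof (rule card_UN_disjoint)
    show "finite {i. [i] \<in> t}"
      using finite_children[OF t canonical_tree_Nil[OF t]] by simp
    show "\<forall>i\<in>{i. [i] \<in> t}. finite ((\<lambda>j. [i, j]) ` {j. [i, j] \<in> t})"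
    proof
      fix i assume "i \<in> {i. [i] \<in> t}"
      then show "finite ((\<lambda>j. [i, j]) ` {j. [i, j] \<in> t})"
        using finite_children[OF t, of "[i]"] by simp
    qed
  qed auto
  also have "\<dots> = (\<Sum>i\<in>{i. [i] \<in> t}. gen_size (Suc 0) (subtree t i))"
    by (intro sum.cong) (auto simp: card_image inj_on_def gen_size_1 subtree_def)
  finally show ?thesis by (simp add: gen_size_def)
qed

section \<open>First generations and subtrees of trees given by offspring numbers\<close>

lemma singleton_mem_tree_of: "[i] \<in> tree_of c \<longleftrightarrow> i \<in> {1..c []}"
  by (simp add: tree_of_def)

lemma Cons_mem_tree_of:
  "i # v \<in> tree_of c \<longleftrightarrow> i \<in> {1..c []} \<and> v \<in> tree_of (\<lambda>m. c (i # m))"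
  unfolding tree_of_def by (auto simp: less_Suc_eq_0_disj)

lemma subtree_tree_of:
  assumes "i \<in> {1..c []}" shows "subtree (tree_of c) i = tree_of (\<lambda>m. c (i # m))"
  using assms by (simp add: subtree_def Cons_mem_tree_of)

lemma gen_size_1_tree_of: "gen_size (Suc 0) (tree_of c) = c []"
  unfolding gen_size_1 singleton_mem_tree_of Collect_mem_eq by simp

lemma gen_size_2_tree_of: "gen_size 2 (tree_of c) = (\<Sum>i=1..c []. c [i])"
  unfolding gen_size_2[OF canonical_tree_of] singleton_mem_tree_of Collect_mem_eq
  by (intro sum.cong refl) (simp only: subtree_tree_of gen_size_1_tree_of)

section \<open>First generations and subtrees of augmented trees\<close>

lemma singleton_mem_augment:
  assumes "[] \<in> \<tau>"
  shows "[i] \<in> augment (N, G) \<tau> \<longleftrightarrow>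
    [i] \<in> \<tau> \<or> (\<exists>j\<in>{1..N []}. i = num_children \<tau> [] + j)"
proof -
  have "(\<exists>m j v. [i] = m @ (num_children \<tau> m + j) # v \<and>
      m \<in> \<tau> \<and> j \<in> {1..N m} \<and> v \<in> tree_of (G (m, j))) \<longleftrightarrow>
    (\<exists>j\<in>{1..N []}. i = num_children \<tau> [] + j)" (is "?L \<longleftrightarrow> ?R")
  proof
    assume ?L
    then obtain m j v where *: "[i] = m @ (num_children \<tau> m + j) # v" "j \<in> {1..N m}" by blast
    then have "m = []" by (cases m) auto
    then show ?R using * by auto
  next
    assume ?R
    then obtain j where "j \<in> {1..N []}" "i = num_children \<tau> [] + j" by blast
    moreover have "[] \<in> tree_of (G ([], j))" by (simp add: tree_of_def)
    ultimately show ?L using assms by (intro exI[of _ "[]"] exI[of _ j]) simp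
  qed
  then show ?thesis unfolding augment_iff by blast
qed

lemma gen_size_1_augment:
  assumes \<tau>: "canonical_tree \<tau>"
  shows "gen_size (Suc 0) (augment (N, G) \<tau>) = gen_size (Suc 0) \<tau> + N []"
proof -
  define c where "c = num_children \<tau> []"
  note Nil = canonical_tree_Nil[OF \<tau>]
  have ch: "[i] \<in> \<tau> \<longleftrightarrow> i \<in> {1..c}" for i
    using canonical_tree_children[OF \<tau> Nil] by (simp add: c_def)
  have aug: "[i] \<in> augment (N, G) \<tau> \<longleftrightarrow> i \<in> {1..c + N []}" for i
  proof -
    have "(\<exists>j\<in>{1..N []}. i = c + j) \<longleftrightarrow> i \<in> {c + 1..c + N []}"
    proof
      assume "i \<in> {c + 1..c + N []}"
      then show "\<exists>j\<in>{1..N []}. i = c + j" by (intro bexI[of _ "i - c"]) auto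
    qed auto
    then show ?thesis unfolding singleton_mem_augment[OF Nil] c_def[symmetric] ch by auto
  qed
  show ?thesis unfolding gen_size_1 ch aug Collect_mem_eq by simp
qed

text \<open>Augmentation acts locally: below an old child it is again an augmentation, driven by the
  part of the sample indexed below that child. This is what allows recursion along old
  children.\<close>

lemma subtree_augment:
  assumes \<tau>: "canonical_tree \<tau>" and i: "[i] \<in> \<tau>"
  shows "subtree (augment (N, G) \<tau>) i =
    augment (\<lambda>m. N (i # m), \<lambda>(m, j). G (i # m, j)) (subtree \<tau> i)"
proof -
  have num: "num_children (subtree \<tau> i) m = num_children \<tau> (i # m)" for m
    by (simp add: num_children_def subtree_def)
  \<comment> \<open>New children of the root have labels above
    \<open>num_children \<tau> []\<close>, so a node \<open>i # v\<close> cannot stem from a copy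
    grafted at the root.\<close>
  have le: "i \<le> num_children \<tau> []"
    using canonical_tree_children[OF \<tau> canonical_tree_Nil[OF \<tau>], of i] i by simp
  have "i # v \<in> augment (N, G) \<tau> \<longleftrightarrow>
      v \<in> augment (\<lambda>m. N (i # m), \<lambda>(m, j). G (i # m, j)) (subtree \<tau> i)" for v
  proof -
    have "(\<exists>m j w. i # v = m @ (num_children \<tau> m + j) # w \<and>
        m \<in> \<tau> \<and> j \<in> {1..N m} \<and> w \<in> tree_of (G (m, j))) \<longleftrightarrow>
      (\<exists>m j w. v = m @ (num_children \<tau> (i # m) + j) # w \<and>
        i # m \<in> \<tau> \<and> j \<in> {1..N (i # m)} \<and> w \<in> tree_of (G (i # m, j)))" (is "?L \<longleftrightarrow> ?R")
    proof
      assume ?L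
      then obtain m j w where *: "i # v = m @ (num_children \<tau> m + j) # w"
        "m \<in> \<tau>" "j \<in> {1..N m}" "w \<in> tree_of (G (m, j))" by blast
      show ?R
      proof (cases m)
        case Nil
        then show ?thesis using * le by simp
      next
        case (Cons a m')
        then show ?thesis using * by auto
      qed
    next
      assume ?R
      then obtain m j w where *: "v = m @ (num_children \<tau> (i # m) + j) # w"
        "i # m \<in> \<tau>" "j \<in> {1..N (i # m)}" "w \<in> tree_of (G (i # m, j))" by blast
      then show ?L by (intro exI[of _ "i # m"] exI[of _ j] exI[of _ w]) simp
    qed
    then show ?thesis unfolding augment_iff num by (simp add: subtree_def)
  qed
  then show ?thesis by (auto simp: subtree_def)
qed

lemma gen_size_2_augment:
  assumes \<tau>: "canonical_tree \<tau>" and N: "N [] = 0"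
  shows "gen_size 2 (augment (N, G) \<tau>) = gen_size 2 \<tau> + (\<Sum>i\<in>{i. [i] \<in> \<tau>}. N [i])"
proof -
  have "{i. [i] \<in> augment (N, G) \<tau>} = {i. [i] \<in> \<tau>}"
    using singleton_mem_augment[OF canonical_tree_Nil[OF \<tau>]] N by simp
  then have "gen_size 2 (augment (N, G) \<tau>) =
      (\<Sum>i\<in>{i. [i] \<in> \<tau>}. gen_size (Suc 0) (subtree \<tau> i) + N [i])"
    unfolding gen_size_2[OF canonical_augment[OF \<tau>]]
    by (intro sum.cong) (simp_all only: mem_Collect_eq subtree_augment[OF \<tau>]
        gen_size_1_augment[OF canonical_subtree[OF \<tau>]])
  then show ?thesis by (simp add: gen_size_2[OF \<tau>] sum.distrib)
qed

text \<open>The counterpart of \<open>new_label_snoc\<close> that splits off the root instead of the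
  last step, as required because \<open>corr\<close> recurses from the root.\<close>

lemma new_label_Cons:
  "new_label \<sigma> t (i # v) = \<sigma> ([], num_children t []) i #
     new_label (\<lambda>(m, c). \<sigma> (i # m, c)) (subtree t i) v"
proof (induction v rule: rev_induct)
  case Nil
  show ?case using new_label_snoc[of \<sigma> t "[]" i] by simp
next
  case (snoc j v)
  have "num_children (subtree t i) v = num_children t (i # v)"
    by (simp add: num_children_def subtree_def)
  then show ?case
    using snoc new_label_snoc[of \<sigma> t "i # v" j] by (simp add: new_label_snoc)
qed

lemma inj_new_label:
  assumes "\<And>m c. inj (\<sigma> (m, c))" shows "inj (new_label \<sigma> t)"
proof (rule injI)
  fix v w assume "new_label \<sigma> t v = new_label \<sigma> t w"
  then show "v = w" using assms
  proof (induction v arbitrary: w \<sigma> t)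
    case Nil
    then show ?case by (metis length_new_label list.size(3) length_0_conv)
  next
    case (Cons i v)
    then have "length w = Suc (length v)" by (metis length_new_label length_Cons)
    then obtain j w' where w: "w = j # w'" by (cases w) auto
    then have "\<sigma> ([], num_children t []) i = \<sigma> ([], num_children t []) j"
      using Cons.prems(1) by (simp add: new_label_Cons)
    then have "i = j" using Cons.prems(2) by (auto simp: inj_def)
    then show ?case using Cons.prems Cons.IH[of "\<lambda>(m, c). \<sigma> (i # m, c)" "subtree t i" w'] w
      by (simp add: new_label_Cons)
  qed
qed

lemma gen_size_relabel:
  assumes "\<And>m c. inj (\<sigma> (m, c))" shows "gen_size l (relabel \<sigma> t) = gen_size l t"
proof -
  have "{m \<in> relabel \<sigma> t. length m = l} = new_label \<sigma> t ` {m \<in> t. length m = l}"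
    by (auto simp: relabel_def)
  then show ?thesis
    using inj_new_label[of \<sigma> t, OF assms] by (simp add: gen_size_def card_image inj_on_subset)
qed

lemma subtree_relabel:
  assumes "\<And>m c. inj (\<sigma> (m, c))"
  shows "subtree (relabel \<sigma> t) (\<sigma> ([], num_children t []) i) =
    relabel (\<lambda>(m, c). \<sigma> (i # m, c)) (subtree t i)" (is "?L = ?R")
proof (intro set_eqI iffI)
  fix v assume "v \<in> ?L"
  then obtain w where w: "w \<in> t" "new_label \<sigma> t w = \<sigma> ([], num_children t []) i # v"
    by (auto simp: subtree_def relabel_def)
  then obtain j w' where w': "w = j # w'" by (cases w) auto
  then have "j = i" using w assms by (auto simp: new_label_Cons inj_def)
  then show "v \<in> ?R" using w w' by (auto simp: new_label_Cons subtree_def relabel_def)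
next
  fix v assume "v \<in> ?R"
  then obtain w where w: "i # w \<in> t" "v = new_label (\<lambda>(m, c). \<sigma> (i # m, c)) (subtree t i) w"
    by (auto simp: subtree_def relabel_def)
  then have "new_label \<sigma> t (i # w) = \<sigma> ([], num_children t []) i # v"
    by (simp only: new_label_Cons)
  then show "v \<in> ?L" using w(1) unfolding subtree_def relabel_def by (metis imageI mem_Collect_eq)
qed

text \<open>Permuting children only renames the two sides of a matching. Hence the planted trees can
  be analysed before relabelling, where the common old nodes still carry the same labels.\<close>

lemma corr_relabel:
  assumes "corr k K n t t'" "\<And>m c. inj (\<sigma> (m, c))" "\<And>m c. inj (\<sigma>' (m, c))"
  shows "corr k K n (relabel \<sigma> t) (relabel \<sigma>' t')"
  using assms
proof (induction n arbitrary: t t' \<sigma> \<sigma>')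
  case 0
  then show ?case by (simp add: gen_size_relabel)
next
  case (Suc n)
  define \<pi> where "\<pi> = \<sigma> ([], num_children t [])"
  define \<pi>' where "\<pi>' = \<sigma>' ([], num_children t' [])"
  have inj: "inj \<pi>" "inj \<pi>'" using Suc.prems by (simp_all add: \<pi>_def \<pi>'_def)
  obtain I f where I: "card I = k" "inj_on f I"
    "\<And>i. i \<in> I \<Longrightarrow> [i] \<in> t \<and> [f i] \<in> t' \<and> corr k K n (subtree t i) (subtree t' (f i))"
    using Suc.prems(1) by auto
  have mem: "[\<sigma> ([], num_children t []) i] \<in> relabel \<sigma> t" if "[i] \<in> t" for i t \<sigma>
    unfolding relabel_def by (rule image_eqI[OF _ that]) (simp add: new_label_Cons)
  have "[\<pi> i] \<in> relabel \<sigma> t \<and> [\<pi>' (f i)] \<in> relabel \<sigma>' t' \<and>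
      corr k K n (subtree (relabel \<sigma> t) (\<pi> i)) (subtree (relabel \<sigma>' t') (\<pi>' (f i)))"
    if "i \<in> I" for i
    unfolding \<pi>_def \<pi>'_def
      subtree_relabel[of \<sigma>, OF Suc.prems(2)] subtree_relabel[of \<sigma>', OF Suc.prems(3)]
    using I(3)[OF that] Suc.prems(2,3) by (intro conjI mem Suc.IH) auto
  moreover have "card (\<pi> ` I) = k" using I inj by (simp add: card_image inj_on_subset)
  \<comment> \<open>The transported matching is \<open>f\<close> conjugated by the two root
    permutations: undo \<open>\<pi>\<close>, apply \<open>f\<close>, then apply
    \<open>\<pi>'\<close>.\<close>
  moreover have "inj_on (\<lambda>x. \<pi>' (f (inv \<pi> x))) (\<pi> ` I)"
  proof (rule inj_onI)
    fix x y assume "x \<in> \<pi> ` I" "y \<in> \<pi> ` I" and eq: "\<pi>' (f (inv \<pi> x)) = \<pi>' (f (inv \<pi> y))"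
    then obtain i j where "x = \<pi> i" "y = \<pi> j" "i \<in> I" "j \<in> I" by blast
    then show "x = y" using eq I(2) inj by (simp add: inj_eq inj_on_eq_iff)
  qed
  ultimately have "\<exists>J g. card J = k \<and> inj_on g J \<and> (\<forall>i\<in>J. [i] \<in> relabel \<sigma> t \<and>
      [g i] \<in> relabel \<sigma>' t' \<and> corr k K n (subtree (relabel \<sigma> t) i) (subtree (relabel \<sigma>' t') (g i)))"
    using inj by (intro exI[of _ "\<pi> ` I"] exI[of _ "\<lambda>x. \<pi>' (f (inv \<pi> x))"]) simp
  moreover have "gen_size (Suc 0) t \<le> 9 * k" "gen_size (Suc 0) t' \<le> 9 * k"
    using Suc.prems(1) by auto
  ultimately show ?case by (simp only: corr.simps
        gen_size_relabel[of \<sigma>, OF Suc.prems(2)] gen_size_relabel[of \<sigma>', OF Suc.prems(3)])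
qed

subsection \<open>Independent families on product spaces\<close>

text \<open>Independence is handled through generators of \<open>\<sigma>\<close>-algebras rather than random variables, since
  the coordinates attached to a node take values in different types.\<close>

definition zip_sets :: "('i \<Rightarrow> 'a set set) \<Rightarrow> ('i \<Rightarrow> 'b set set) \<Rightarrow> 'i \<Rightarrow> ('a \<times> 'b) set set" where
  "zip_sets F G i = {A \<times> B | A B. A \<in> F i \<and> B \<in> G i}"

definition gen_alg :: "'a measure \<Rightarrow> ('i \<Rightarrow> 'a set set) \<Rightarrow> 'i set \<Rightarrow> 'a measure" where
  "gen_alg M F L = sigma (space M) (\<Union>i\<in>L. F i)"

text \<open>Stability under intersection lets independence pass to generated sigma-algebras. Having
  the whole space in every family makes cylinders such as \<open>A \<times> space N\<close> members
  of a zipped family.\<close>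

definition indep_gen :: "'a measure \<Rightarrow> ('i \<Rightarrow> 'a set set) \<Rightarrow> 'i set \<Rightarrow> bool" where
  "indep_gen M F I \<longleftrightarrow> prob_space M \<and> prob_space.indep_sets M F I \<and>
     (\<forall>i\<in>I. Int_stable (F i) \<and> space M \<in> F i)"

lemma indep_gen_subset: "indep_gen M F I \<Longrightarrow> i \<in> I \<Longrightarrow> F i \<subseteq> sets M"
  unfolding indep_gen_def by (auto dest!: prob_space.indep_sets_def[THEN iffD1, rotated])

lemma indep_gen_UN_Pow:
  assumes "indep_gen M F I" "L \<subseteq> I" shows "(\<Union>i\<in>L. F i) \<subseteq> Pow (space M)"
  using indep_gen_subset[OF assms(1)] assms(2) sets.sets_into_space by blast

lemma space_gen_alg [simp]: "space (gen_alg M F L) = space M"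
  by (simp add: gen_alg_def space_measure_of_conv)

lemma sets_gen_alg:
  assumes "indep_gen M F I" "L \<subseteq> I"
  shows "sets (gen_alg M F L) = sigma_sets (space M) (\<Union>i\<in>L. F i)"
  unfolding gen_alg_def by (rule sets_measure_of[OF indep_gen_UN_Pow[OF assms]])

lemma sets_gen_algI:
  assumes "indep_gen M F I" "L \<subseteq> I" "i \<in> L" "A \<in> F i" shows "A \<in> sets (gen_alg M F L)"
  using assms(3,4) unfolding sets_gen_alg[OF assms(1,2)] by (blast intro: sigma_sets.Basic)

lemma sets_gen_alg_subset:
  assumes "indep_gen M F I" "L \<subseteq> I" shows "sets (gen_alg M F L) \<subseteq> sets M"
  unfolding sets_gen_alg[OF assms] using indep_gen_subset[OF assms(1)] assms(2)
  by (intro sets.sigma_sets_subset) blast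

text \<open>Grouping: disjoint blocks of an independent family generate independent sigma-algebras.
  With blocks of descendants this yields independence of the data in disjoint subtrees.\<close>

lemma indep_gen_block:
  assumes F: "indep_gen M F I" and L: "\<And>j. j \<in> J \<Longrightarrow> L j \<subseteq> I" "disjoint_family_on L J"
  shows "indep_gen M (\<lambda>j. sets (gen_alg M F (L j))) J"
proof -
  interpret prob_space M using F by (simp add: indep_gen_def)
  have "indep_sets (\<lambda>j. sigma_sets (space M) (\<Union>i\<in>L j. F i)) J"
  proof (rule indep_sets_collect_sigma)
    show "indep_sets F (\<Union>j\<in>J. L j)"
      using F L(1) by (auto simp: indep_gen_def intro: indep_sets_mono_index[rotated])
    show "Int_stable (F i)" if "j \<in> J" "i \<in> L j" for i j
      using F L(1) that by (auto simp: indep_gen_def)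
  qed fact
  then have "indep_sets (\<lambda>j. sets (gen_alg M F (L j))) J"
    by (rule indep_sets_mono_sets) (simp add: sets_gen_alg[OF F L(1)])
  moreover have "space M \<in> sets (gen_alg M F (L j))" for j
    using sets.top[of "gen_alg M F (L j)"] by simp
  ultimately show ?thesis
    by (auto simp: indep_gen_def prob_space_axioms sets.Int_stable)
qed

text \<open>Intersections of rectangles are rectangles, so probabilities factor over the two spaces,
  then over the indices, and regroup index by index. Both samples may thus be regarded as attached
  to the same index.\<close>

lemma indep_gen_zip:
  assumes F: "indep_gen M F I" and G: "indep_gen N G I"
  shows "indep_gen (M \<Otimes>\<^sub>M N) (zip_sets F G) I"
proof -
  interpret M: prob_space M using F by (simp add: indep_gen_def)
  interpret N: prob_space N using G by (simp add: indep_gen_def)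
  interpret P: pair_prob_space M N ..
  have times: "P.prob (A \<times> B) = M.prob A * N.prob B" if "A \<in> sets M" "B \<in> sets N" for A B
    using that by (simp add: measure_def N.emeasure_pair_measure_Times enn2real_mult)
  have "P.indep_sets (zip_sets F G) I"
    unfolding P.indep_sets_def
  proof (intro conjI ballI allI impI)
    fix i assume "i \<in> I"
    then show "zip_sets F G i \<subseteq> P.events"
      using indep_gen_subset[OF F] indep_gen_subset[OF G] unfolding zip_sets_def
      by (blast intro: pair_measureI)
  next
    fix J X assume J: "J \<subseteq> I" "J \<noteq> {}" "finite J" and X: "X \<in> Pi J (zip_sets F G)"
    have "\<forall>j\<in>J. \<exists>A B. X j = A \<times> B \<and> A \<in> F j \<and> B \<in> G j"
      using X by (auto simp: Pi_def zip_sets_def)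
    then obtain A B where AB: "\<And>j. j \<in> J \<Longrightarrow> X j = A j \<times> B j \<and> A j \<in> F j \<and> B j \<in> G j"
      by metis
    then have ev: "A j \<in> sets M" "B j \<in> sets N" if "j \<in> J" for j
      using that J indep_gen_subset[OF F] indep_gen_subset[OF G] by blast+
    have "(\<Inter>j\<in>J. X j) = (\<Inter>j\<in>J. A j) \<times> (\<Inter>j\<in>J. B j)"
      using AB J(2) by auto
    then have "P.prob (\<Inter>j\<in>J. X j) = M.prob (\<Inter>j\<in>J. A j) * N.prob (\<Inter>j\<in>J. B j)"
      using ev J by (simp add: times sets.finite_INT)
    also have "M.prob (\<Inter>j\<in>J. A j) = (\<Prod>j\<in>J. M.prob (A j))"
      using F J AB by (intro M.indep_setsD[of F I]) (auto simp: indep_gen_def)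
    also have "N.prob (\<Inter>j\<in>J. B j) = (\<Prod>j\<in>J. N.prob (B j))"
      using G J AB by (intro N.indep_setsD[of G I]) (auto simp: indep_gen_def)
    also have "(\<Prod>j\<in>J. M.prob (A j)) * (\<Prod>j\<in>J. N.prob (B j)) = (\<Prod>j\<in>J. P.prob (X j))"
      unfolding prod.distrib[symmetric] using AB ev by (intro prod.cong) (auto simp: times)
    finally show "P.prob (\<Inter>j\<in>J. X j) = (\<Prod>j\<in>J. P.prob (X j))" .
  qed
  moreover have "Int_stable (zip_sets F G i)" if "i \<in> I" for i
  proof (rule Int_stableI)
    fix a b assume "a \<in> zip_sets F G i" "b \<in> zip_sets F G i"
    then obtain A B A' B' where "a = A \<times> B" "b = A' \<times> B'"
      "A \<in> F i" "A' \<in> F i" "B \<in> G i" "B' \<in> G i" by (auto simp: zip_sets_def)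
    moreover from this have "A \<inter> A' \<in> F i" "B \<inter> B' \<in> G i"
      using that F G by (auto simp: indep_gen_def Int_stable_def)
    ultimately show "a \<inter> b \<in> zip_sets F G i"
      by (auto simp: zip_sets_def Times_Int_Times)
  qed
  moreover have "space (M \<Otimes>\<^sub>M N) \<in> zip_sets F G i" if "i \<in> I" for i
    using that F G by (auto simp: zip_sets_def space_pair_measure indep_gen_def)
  ultimately show ?thesis
    by (simp add: indep_gen_def P.prob_space_axioms)
qed

lemma measurable_fst_zip:
  assumes F: "indep_gen M F I" and G: "indep_gen N G I" and L: "L \<subseteq> I"
  shows "fst \<in> gen_alg (M \<Otimes>\<^sub>M N) (zip_sets F G) L \<rightarrow>\<^sub>M gen_alg M F L"
  unfolding gen_alg_def[of M]
proof (rule measurable_measure_of[OF indep_gen_UN_Pow[OF F L]])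
  fix A assume "A \<in> (\<Union>i\<in>L. F i)"
  then obtain i where i: "i \<in> L" "A \<in> F i" by blast
  then have A: "A \<subseteq> space M" "space N \<in> G i"
    using indep_gen_UN_Pow[OF F L] G L by (auto simp: indep_gen_def)
  have "A \<times> space N \<in> sets (gen_alg (M \<Otimes>\<^sub>M N) (zip_sets F G) L)"
    using i A by (intro sets_gen_algI[OF indep_gen_zip[OF F G] L, of i]) (auto simp: zip_sets_def)
  moreover have "fst -` A \<inter> space (gen_alg (M \<Otimes>\<^sub>M N) (zip_sets F G) L) = A \<times> space N"
    using A by (auto simp: space_pair_measure)
  ultimately show "fst -` A \<inter> space (gen_alg (M \<Otimes>\<^sub>M N) (zip_sets F G) L)
      \<in> sets (gen_alg (M \<Otimes>\<^sub>M N) (zip_sets F G) L)" by simp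
qed (auto simp: space_pair_measure)

lemma measurable_snd_zip:
  assumes F: "indep_gen M F I" and G: "indep_gen N G I" and L: "L \<subseteq> I"
  shows "snd \<in> gen_alg (M \<Otimes>\<^sub>M N) (zip_sets F G) L \<rightarrow>\<^sub>M gen_alg N G L"
  unfolding gen_alg_def[of N]
proof (rule measurable_measure_of[OF indep_gen_UN_Pow[OF G L]])
  fix B assume "B \<in> (\<Union>i\<in>L. G i)"
  then obtain i where i: "i \<in> L" "B \<in> G i" by blast
  then have B: "B \<subseteq> space N" "space M \<in> F i"
    using indep_gen_UN_Pow[OF G L] F L by (auto simp: indep_gen_def)
  have "space M \<times> B \<in> sets (gen_alg (M \<Otimes>\<^sub>M N) (zip_sets F G) L)"
    using i B by (intro sets_gen_algI[OF indep_gen_zip[OF F G] L, of i]) (auto simp: zip_sets_def)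
  moreover have "snd -` B \<inter> space (gen_alg (M \<Otimes>\<^sub>M N) (zip_sets F G) L) = space M \<times> B"
    using B by (auto simp: space_pair_measure)
  ultimately show "snd -` B \<inter> space (gen_alg (M \<Otimes>\<^sub>M N) (zip_sets F G) L)
      \<in> sets (gen_alg (M \<Otimes>\<^sub>M N) (zip_sets F G) L)" by simp
qed (auto simp: space_pair_measure)

text \<open>The form in which independence is applied: events depending on disjoint blocks of
  indices, each of probability at most \<open>q\<close>, occur jointly with probability at most
  \<open>q ^ card J\<close>. The empty index set is separate because the product formula for
  independent sets asks for a nonempty one.\<close>

lemma indep_gen_prob_le:
  assumes F: "indep_gen M F I" and J: "finite J" "disjoint_family_on L J"
    and L: "\<And>j. j \<in> J \<Longrightarrow> L j \<subseteq> I"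
    and P: "\<And>j. j \<in> J \<Longrightarrow> Measurable.pred (gen_alg M F (L j)) (P j)"
    and q: "\<And>j. j \<in> J \<Longrightarrow> measure M {\<omega> \<in> space M. P j \<omega>} \<le> q"
  shows "measure M {\<omega> \<in> space M. \<forall>j\<in>J. P j \<omega>} \<le> q ^ card J"
proof (cases "J = {}")
  case False
  interpret prob_space M using F by (simp add: indep_gen_def)
  have "{\<omega> \<in> space M. \<forall>j\<in>J. P j \<omega>} = (\<Inter>j\<in>J. {\<omega> \<in> space M. P j \<omega>})" using False by auto
  also have "prob \<dots> = (\<Prod>j\<in>J. prob {\<omega> \<in> space M. P j \<omega>})"
  proof (rule indep_setsD)
    show "indep_sets (\<lambda>j. sets (gen_alg M F (L j))) J"
      using indep_gen_block[OF F L J(2)] by (simp add: indep_gen_def)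
    show "\<forall>j\<in>J. {\<omega> \<in> space M. P j \<omega>} \<in> sets (gen_alg M F (L j))"
    proof
      fix j assume "j \<in> J"
      from P[OF this] have "{\<omega> \<in> space (gen_alg M F (L j)). P j \<omega>} \<in> sets (gen_alg M F (L j))"
        by (simp only: pred_def)
      then show "{\<omega> \<in> space M. P j \<omega>} \<in> sets (gen_alg M F (L j))" by simp
    qed
  qed (use J False in auto)
  also have "\<dots> \<le> (\<Prod>j\<in>J. q)" using q by (intro prod_mono) auto
  finally show ?thesis by simp
qed (use F in \<open>simp add: indep_gen_def prob_space.prob_space\<close>)

section \<open>Coordinates of infinite product measures\<close>

definition coord_sets :: "('i \<Rightarrow> 'a measure) \<Rightarrow> 'i \<Rightarrow> ('i \<Rightarrow> 'a) set set" where
  "coord_sets M i = {(\<lambda>\<omega>. \<omega> i) -` A \<inter> space (PiM UNIV M) | A. A \<in> sets (M i)}"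

lemma indep_gen_PiM:
  assumes "\<And>i. prob_space (M i)"
  shows "indep_gen (PiM UNIV M) (coord_sets M) UNIV"
proof -
  interpret product_prob_space M UNIV using assms
    by (simp add: product_prob_space_def product_sigma_finite_def product_prob_space_axioms_def
        prob_space_imp_sigma_finite)
  have cyl: "P.prob (\<Inter>j\<in>J. (\<lambda>\<omega>. \<omega> j) -` A j \<inter> space (PiM UNIV M)) = (\<Prod>j\<in>J. measure (M j) (A j))"
    if "finite J" "J \<noteq> {}" "\<And>j. j \<in> J \<Longrightarrow> A j \<in> sets (M j)" for J A
  proof -
    have "(\<Inter>j\<in>J. (\<lambda>\<omega>. \<omega> j) -` A j \<inter> space (PiM UNIV M)) =
        {\<omega> \<in> space (PiM UNIV M). \<forall>j\<in>J. \<omega> j \<in> A j}" using that(2) by blast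
    moreover have "emeasure (PiM UNIV M) {\<omega> \<in> space (PiM UNIV M). \<forall>j\<in>J. \<omega> j \<in> A j} =
        (\<Prod>j\<in>J. emeasure (M j) (A j))"
      using that by (intro emeasure_PiM_Collect) auto
    ultimately show ?thesis
      by (simp add: P.emeasure_eq_measure M.emeasure_eq_measure prod_ennreal prod_nonneg)
  qed
  have "P.indep_sets (coord_sets M) UNIV"
    unfolding P.indep_sets_def
  proof (intro conjI ballI allI impI)
    fix i show "coord_sets M i \<subseteq> P.events"
      by (auto simp: coord_sets_def intro!: measurable_sets[OF measurable_component_singleton])
  next
    fix J X assume J: "J \<subseteq> UNIV" "J \<noteq> {}" "finite J" and X: "X \<in> Pi J (coord_sets M)"
    have "\<forall>j\<in>J. \<exists>A. X j = (\<lambda>\<omega>. \<omega> j) -` A \<inter> space (PiM UNIV M) \<and> A \<in> sets (M j)"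
      using X by (auto simp: Pi_def coord_sets_def)
    then obtain A where
      A: "\<And>j. j \<in> J \<Longrightarrow> X j = (\<lambda>\<omega>. \<omega> j) -` A j \<inter> space (PiM UNIV M) \<and> A j \<in> sets (M j)"
      by metis
    have "P.prob (\<Inter>j\<in>J. X j) = P.prob (\<Inter>j\<in>J. (\<lambda>\<omega>. \<omega> j) -` A j \<inter> space (PiM UNIV M))"
      using A by (simp cong: INF_cong_simp)
    also have "\<dots> = (\<Prod>j\<in>J. measure (M j) (A j))" using J A by (intro cyl) auto
    also have "\<dots> = (\<Prod>j\<in>J. P.prob (X j))"
    proof (rule prod.cong)
      fix j assume "j \<in> J"
      then show "measure (M j) (A j) = P.prob (X j)" using A[of j] cyl[of "{j}" A] by simp
    qed simp
    finally show "P.prob (\<Inter>j\<in>J. X j) = (\<Prod>j\<in>J. P.prob (X j))" .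
  qed
  moreover have "Int_stable (coord_sets M i)" for i
  proof (rule Int_stableI)
    fix a b assume "a \<in> coord_sets M i" "b \<in> coord_sets M i"
    then obtain A B where "a = (\<lambda>\<omega>. \<omega> i) -` A \<inter> space (PiM UNIV M)" "A \<in> sets (M i)"
      "b = (\<lambda>\<omega>. \<omega> i) -` B \<inter> space (PiM UNIV M)" "B \<in> sets (M i)" by (auto simp: coord_sets_def)
    then have "a \<inter> b = (\<lambda>\<omega>. \<omega> i) -` (A \<inter> B) \<inter> space (PiM UNIV M)" "A \<inter> B \<in> sets (M i)" by auto
    then show "a \<inter> b \<in> coord_sets M i" unfolding coord_sets_def by blast
  qed
  moreover have "space (PiM UNIV M) \<in> coord_sets M i" for i
  proof -
    have "space (PiM UNIV M) = (\<lambda>\<omega>. \<omega> i) -` space (M i) \<inter> space (PiM UNIV M)"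
      by (auto simp: space_PiM)
    then show ?thesis unfolding coord_sets_def by blast
  qed
  ultimately show ?thesis by (simp add: indep_gen_def P.prob_space_axioms)
qed

text \<open>The coordinate \<open>j\<close> and the index \<open>i\<close> are kept apart because
  one family \<open>F i\<close> may carry many coordinates, for instance those of a whole
  subtree.\<close>

lemma measurable_coord_gen:
  assumes "indep_gen (PiM UNIV M) F I" "L \<subseteq> I" "i \<in> L" "coord_sets M j \<subseteq> F i"
  shows "(\<lambda>\<omega>. \<omega> j) \<in> gen_alg (PiM UNIV M) F L \<rightarrow>\<^sub>M M j"
proof (rule measurableI)
  fix A assume "A \<in> sets (M j)"
  then have "(\<lambda>\<omega>. \<omega> j) -` A \<inter> space (PiM UNIV M) \<in> F i"
    using assms(4) by (auto simp: coord_sets_def)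
  from sets_gen_algI[OF assms(1-3) this]
  show "(\<lambda>\<omega>. \<omega> j) -` A \<inter> space (gen_alg (PiM UNIV M) F L) \<in> sets (gen_alg (PiM UNIV M) F L)"
    by simp
qed (auto simp: space_PiM)

subsection \<open>Independent trees\<close>

text \<open>By \<open>corr_prune\<close> the relation factors through the pruned trees. They are
  measurable maps into a countable discrete space, on which every predicate is measurable.\<close>

lemma measurable_corr:
  assumes "\<And>m. Measurable.pred M (\<lambda>\<omega>. m \<in> t \<omega>)" "\<And>m. Measurable.pred M (\<lambda>\<omega>. m \<in> t' \<omega>)"
    and "\<And>\<omega>. \<omega> \<in> space M \<Longrightarrow> canonical_tree (t \<omega>)" "\<And>\<omega>. \<omega> \<in> space M \<Longrightarrow> canonical_tree (t' \<omega>)"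
  shows "Measurable.pred M (\<lambda>\<omega>. corr k K n (t \<omega>) (t' \<omega>))"
proof -
  let ?d = "Suc (Suc n)"
  have "(\<lambda>\<omega>. map_prod (prune ?d) (prune ?d) (t \<omega>, t' \<omega>))
      \<in> M \<rightarrow>\<^sub>M count_space (trees_upto ?d \<times> trees_upto ?d)"
    using measurable_prune[OF assms(1,3)] measurable_prune[OF assms(2,4)]
    by (intro measurable_prune_pair) simp_all
  then have "(\<lambda>\<omega>. (\<lambda>(a, b). corr k K n a b) (map_prod (prune ?d) (prune ?d) (t \<omega>, t' \<omega>)))
      \<in> M \<rightarrow>\<^sub>M count_space UNIV"
    by (rule measurable_compose) simp
  then show ?thesis by (simp add: corr_prune)
qed

text \<open>Offspring numbers seen from \<open>u\<close>. They are defined even when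
  \<open>u\<close> is not a node of the tree, so bounds can be stated for all labels without
  conditioning on membership.\<close>

definition shift :: "label \<Rightarrow> (label \<Rightarrow> nat) \<Rightarrow> label \<Rightarrow> nat" where
  "shift u c m = c (u @ m)"

lemma shift_Cons: "(\<lambda>m. shift u c (i # m)) = shift (u @ [i]) c"
  by (simp add: shift_def fun_eq_iff)

definition descendants :: "label \<Rightarrow> label set" where
  "descendants u = range (append u)"

definition gw_gen :: "real \<Rightarrow> label \<Rightarrow> (label \<Rightarrow> nat) set set" where
  "gw_gen \<mu> = coord_sets (\<lambda>_. measure_pmf (poisson \<mu>))"

lemma indep_gen_gw: "indep_gen (gw_space \<mu>) (gw_gen \<mu>) UNIV"
  unfolding gw_space_def gw_gen_def by (rule indep_gen_PiM) (rule measure_pmf.prob_space_axioms)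

lemma measurable_shift:
  assumes "indep_gen (gw_space \<mu>) F I" "L \<subseteq> I" 
    "\<And>m. \<exists>i\<in>L. gw_gen \<mu> (u @ m) \<subseteq> F i"
  shows "shift u \<in> gen_alg (gw_space \<mu>) F L \<rightarrow>\<^sub>M gw_space \<mu>"
proof -
  have "(\<lambda>c m. c (u @ m)) \<in> gen_alg (gw_space \<mu>) F L \<rightarrow>\<^sub>M gw_space \<mu>"
    unfolding gw_space_def
  proof (rule measurable_PiM_single')
    fix m :: label
    obtain i where "i \<in> L" "gw_gen \<mu> (u @ m) \<subseteq> F i"
      using assms(3) by blast
    then show "(\<lambda>c. c (u @ m)) \<in> gen_alg (PiM UNIV (\<lambda>_. measure_pmf (poisson \<mu>))) F L \<rightarrow>\<^sub>M
        measure_pmf (poisson \<mu>)"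
      using measurable_coord_gen[OF assms(1,2)[unfolded gw_space_def]]
      unfolding gw_gen_def by blast
  qed simp
  then show ?thesis by (simp add: shift_def[abs_def])
qed

lemma space_gw_space [simp]: "space (gw_space \<mu>) = UNIV"
  by (simp add: gw_space_def space_PiM)

lemma measurable_gw_coord [measurable]: "(\<lambda>c. c m) \<in> gw_space \<mu> \<rightarrow>\<^sub>M count_space UNIV"
  by (rule measurable_offspring[of _ _ "poisson \<mu>"]) (simp add: gw_space_def)

lemma measurable_shift_gw [measurable]: "shift u \<in> gw_space \<mu> \<rightarrow>\<^sub>M gw_space \<mu>"
proof -
  have "(\<lambda>c m. c (u @ m)) \<in> gw_space \<mu> \<rightarrow>\<^sub>M gw_space \<mu>"
    unfolding gw_space_def
    by (rule measurable_PiM_single') (rule measurable_component_singleton, simp_all)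
  then show ?thesis by (simp add: shift_def[abs_def])
qed

text \<open>Induction on \<open>A\<close>: the event is split according to the value
  \<open>z\<close> of one coordinate \<open>a\<close>, which then joins the prescribed coordinates
  \<open>J\<close>; this is why \<open>J\<close> and \<open>y\<close> must vary. Summing over
  \<open>z\<close> is a Poisson convolution.\<close>

lemma prob_gw_sum:
  fixes \<mu> :: real
  assumes \<mu>: "0 \<le> \<mu>" and A: "finite A" and J: "finite J" "J \<inter> A = {}"
  shows "measure (gw_space \<mu>) {c. (\<forall>m\<in>J. c m = y m) \<and> (\<Sum>m\<in>A. c m) = x} =
    (\<Prod>m\<in>J. pmf (poisson \<mu>) (y m)) * pmf (poisson (card A * \<mu>)) x"
  using A J
proof (induction A arbitrary: J y x rule: finite_induct)
  case empty
  interpret product_prob_space "\<lambda>_::label. measure_pmf (poisson \<mu>)" UNIV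
    by (simp add: product_prob_space_def product_sigma_finite_def product_prob_space_axioms_def
        measure_pmf.prob_space_axioms measure_pmf.sigma_finite_measure_axioms)
  have "emeasure (gw_space \<mu>) {c. \<forall>m\<in>J. c m = y m} = (\<Prod>m\<in>J. ennreal (pmf (poisson \<mu>) (y m)))"
    using emeasure_PiM_Collect[of J "\<lambda>m. {y m}"] empty
    by (simp add: gw_space_def space_PiM emeasure_pmf_single)
  then have "measure (gw_space \<mu>) {c. \<forall>m\<in>J. c m = y m} = (\<Prod>m\<in>J. pmf (poisson \<mu>) (y m))"
    by (simp add: measure_def prod_ennreal prod_nonneg)
  \<comment> \<open>The empty sum is 0, and \<open>poisson 0\<close> is the point mass
    there.\<close>
  then show ?case by (cases "x = 0") (simp_all add: poisson_def)
next
  case (insert a A)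
  interpret prob_space "gw_space \<mu>" by (rule prob_space_gw_space)
  define E where "E z = {c. (\<forall>m\<in>insert a J. c m = (y(a := z)) m) \<and> (\<Sum>m\<in>A. c m) = x - z}" for z
  have a: "a \<notin> J" using insert.prems by auto
  have E_eq: "c \<in> E z \<longleftrightarrow> c a = z \<and> (\<forall>m\<in>J. c m = y m) \<and> (\<Sum>m\<in>A. c m) = x - z" for c z
    using a by (auto simp: E_def)
  have ev: "E z \<in> events" for z
  proof -
    have "{c \<in> space (gw_space \<mu>). (\<forall>m\<in>insert a J. c m = (y(a := z)) m) \<and> (\<Sum>m\<in>A. c m) = x - z}
        \<in> events" using insert by measurable
    then show ?thesis by (simp add: E_def)
  qed
  have "{c. (\<forall>m\<in>J. c m = y m) \<and> (\<Sum>m\<in>insert a A. c m) = x} = (\<Union>z\<le>x. E z)"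
    using insert.hyps by (auto simp: E_eq)
  moreover have "prob (\<Union>z\<le>x. E z) = (\<Sum>z\<le>x. prob (E z))"
    using ev by (intro finite_measure_finite_Union) (auto simp: disjoint_family_on_def E_eq)
  moreover have "prob (E z) = (\<Prod>m\<in>J. pmf (poisson \<mu>) (y m)) *
      (pmf (poisson \<mu>) z * pmf (poisson (card A * \<mu>)) (x - z))" for z
  proof -
    have "prob (E z) = (\<Prod>m\<in>insert a J. pmf (poisson \<mu>) ((y(a := z)) m)) *
        pmf (poisson (card A * \<mu>)) (x - z)"
      unfolding E_def using insert.prems insert.hyps by (intro insert.IH) auto
    moreover have "(\<Prod>m\<in>J. pmf (poisson \<mu>) ((y(a := z)) m)) = (\<Prod>m\<in>J. pmf (poisson \<mu>) (y m))"
      using a by (intro prod.cong) auto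
    ultimately show ?thesis using insert.prems a by simp
  qed
  ultimately show ?case
    using insert.hyps \<mu> pmf_poisson_convolution[of \<mu> "card A * \<mu>" x]
    by (simp add: sum_distrib_left[symmetric] distrib_right)
qed

lemma inj_on_snoc: "inj_on (\<lambda>i. u @ [i]) A"
  by (simp add: inj_on_def)

text \<open>Both the degree of \<open>u\<close> and the sum of the \<open>j\<close> offspring
  numbers below it are anticoncentrated; they contribute \<open>3 / sqrt \<mu>\<close> and
  \<open>3 / sqrt (j * \<mu>)\<close>.\<close>

lemma prob_gw_generations_le:
  fixes \<mu> :: real
  assumes \<mu>: "0 < \<mu>" and j: "0 < j"
  shows "measure (gw_space \<mu>) {c. c u = j \<and> (\<Sum>i=1..j. c (u @ [i])) = x} \<le>
    9 / (\<mu> * sqrt j)"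
proof -
  have "measure (gw_space \<mu>) {c. c u = j \<and> (\<Sum>i=1..j. c (u @ [i])) = x} =
      pmf (poisson \<mu>) j * pmf (poisson (j * \<mu>)) x"
    using prob_gw_sum[where \<mu> = \<mu> and A = "(\<lambda>i. u @ [i]) ` {1..j}"
        and J = "{u}" and y = "\<lambda>_. j" and x = x] \<mu>
    by (simp add: sum.reindex inj_on_snoc card_image image_iff)
  also have "\<dots> \<le> (3 / sqrt \<mu>) * (3 / sqrt (j * \<mu>))"
    using \<mu> j by (intro mult_mono pmf_poisson_le) auto
  also have "\<dots> = 9 / (\<mu> * sqrt j)"
    using \<mu> by (simp add: real_sqrt_mult)
  finally show ?thesis .
qed

text \<open>Fubini: a bound that holds uniformly for every fixed first component holds for the
  product measure.\<close>

lemma measure_pair_le: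
  assumes M: "prob_space M" and N: "prob_space N"
    and Q: "Measurable.pred (M \<Otimes>\<^sub>M N) Q"
    and b: "0 \<le> b" "\<And>x. x \<in> space M \<Longrightarrow> measure N {y \<in> space N. Q (x, y)} \<le> b"
  shows "measure (M \<Otimes>\<^sub>M N) {\<omega> \<in> space (M \<Otimes>\<^sub>M N). Q \<omega>} \<le> b"
proof -
  interpret M: prob_space M by fact
  interpret N: prob_space N by fact
  interpret P: pair_prob_space M N ..
  let ?A = "{\<omega> \<in> space (M \<Otimes>\<^sub>M N). Q \<omega>}"
  have "?A \<in> sets (M \<Otimes>\<^sub>M N)" using Q by measurable
  then have "emeasure (M \<Otimes>\<^sub>M N) ?A = (\<integral>\<^sup>+x. emeasure N (Pair x -` ?A) \<partial>M)"
    by (rule N.emeasure_pair_measure_alt)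
  also have "\<dots> \<le> (\<integral>\<^sup>+x. ennreal b \<partial>M)"
  proof (rule nn_integral_mono)
    fix x assume x: "x \<in> space M"
    then have "Pair x -` ?A = {y \<in> space N. Q (x, y)}" by (auto simp: space_pair_measure)
    then show "emeasure N (Pair x -` ?A) \<le> ennreal b"
      using b(2)[OF x] by (simp add: N.emeasure_eq_measure ennreal_leI)
  qed
  also have "\<dots> = ennreal b" by (simp add: M.emeasure_space_1)
  finally show ?thesis using b(1) by (simp add: P.emeasure_eq_measure)
qed

text \<open>All probability bounds are stated for the subtrees at arbitrary labels \<open>u\<close>, \<open>u'\<close>. This makes the
  induction on the depth go through without comparing the laws of different subtrees.\<close>

definition null_corr ::
  "nat \<Rightarrow> nat \<Rightarrow> nat \<Rightarrow> label \<Rightarrow> label \<Rightarrow> (label \<Rightarrow> nat) \<times> (label \<Rightarrow> nat) \<Rightarrow> bool" where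
  "null_corr k K n u u' \<omega> \<longleftrightarrow> corr k K n (tree_of (shift u (fst \<omega>))) (tree_of (shift u' (snd \<omega>)))"

lemma measurable_null_corr_comp:
  assumes "(\<lambda>\<omega>. shift u (fst \<omega>)) \<in> M \<rightarrow>\<^sub>M gw_space lam" "(\<lambda>\<omega>. shift u' (snd \<omega>)) \<in> M \<rightarrow>\<^sub>M gw_space lam"
  shows "Measurable.pred M (null_corr k K n u u')"
  unfolding null_corr_def[abs_def]
  by (intro measurable_corr measurable_mem_tree_of[OF assms(1)] measurable_mem_tree_of[OF assms(2)]
      canonical_tree_of)

lemma measurable_null_corr [measurable]: "Measurable.pred (null_space lam) (null_corr k K n u u')"
  unfolding null_space_def by (rule measurable_null_corr_comp) measurable

text \<open>The first tree is fixed. The second must then reproduce its degree exactly and hit one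
  of at most \<open>2 * K + 1\<close> values with its second generation. The bound for one value is
  worst at the smallest admissible degree \<open>2 * k\<close>.\<close>

lemma prob_null_corr_0:
  fixes lam :: real
  assumes lam: "0 < lam" and k: "0 < k"
  shows "measure (null_space lam) {\<omega> \<in> space (null_space lam). null_corr k K 0 u u' \<omega>} \<le>
    real (2 * K + 1) * (9 / (lam * sqrt (2 * k)))"
proof -
  define b where "b = 9 / (lam * sqrt (2 * k))"
  interpret N: prob_space "gw_space lam" by (rule prob_space_gw_space)
  show ?thesis
    unfolding null_space_def b_def[symmetric]
  proof (rule measure_pair_le[OF prob_space_gw_space prob_space_gw_space])
    show "Measurable.pred (gw_space lam \<Otimes>\<^sub>M gw_space lam) (null_corr k K 0 u u')"
      using measurable_null_corr[of k K 0 u u' lam] by (simp add: null_space_def)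
    show "0 \<le> real (2 * K + 1) * b" using lam by (simp add: b_def)
  next
    fix c
    define S where "S c u = (\<Sum>i=1..c u. c (u @ [i]))" for c :: "label \<Rightarrow> nat" and u
    define x where "x = S c u"
    define E where "E x' = {c'. c' u' = c u \<and> (\<Sum>i=1..c u. c' (u' @ [i])) = x'}" for x'
    have ev: "E x' \<in> N.events" for x'
    proof -
      have "{c' \<in> space (gw_space lam). c' u' = c u \<and> (\<Sum>i=1..c u. c' (u' @ [i])) = x'} \<in> N.events"
        by measurable
      then show ?thesis by (simp add: E_def)
    qed
    have corr_iff: "null_corr k K 0 u u' (c, c') \<longleftrightarrow> c u = c' u' \<and> c u \<in> {2 * k..9 * k} \<and>
        \<bar>int (S c u) - int (S c' u')\<bar> \<le> int K" for c'
      by (simp add: null_corr_def gen_size_1_tree_of gen_size_2_tree_of S_def shift_def)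
    show "N.prob {c' \<in> space (gw_space lam). null_corr k K 0 u u' (c, c')} \<le> real (2 * K + 1) * b"
    proof (cases "2 * k \<le> c u")
      case False
      then have "{c' \<in> space (gw_space lam). null_corr k K 0 u u' (c, c')} = {}"
        unfolding corr_iff by auto
      then show ?thesis using lam by (simp add: b_def)
    next
      case True
      have "{c' \<in> space (gw_space lam). null_corr k K 0 u u' (c, c')} \<subseteq> (\<Union>x'\<in>{x - K..x + K}. E x')"
        
      proof
        fix c' assume "c' \<in> {c' \<in> space (gw_space lam). null_corr k K 0 u u' (c, c')}"
        then have c': "c u = c' u'" "\<bar>int (S c u) - int (S c' u')\<bar> \<le> int K"
          unfolding corr_iff by auto
        then have "S c' u' \<in> {x - K..x + K}" unfolding x_def by auto
        moreover have "c' \<in> E (S c' u')" using c' by (simp add: E_def S_def)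
        ultimately show "c' \<in> (\<Union>x'\<in>{x - K..x + K}. E x')" by blast
      qed
      then have "N.prob {c' \<in> space (gw_space lam). null_corr k K 0 u u' (c, c')} \<le>
          N.prob (\<Union>x'\<in>{x - K..x + K}. E x')"
        using ev by (intro N.finite_measure_mono) auto
      also have "\<dots> \<le> (\<Sum>x'\<in>{x - K..x + K}. N.prob (E x'))"
        using ev by (intro N.finite_measure_subadditive_finite) auto
      also have "\<dots> \<le> (\<Sum>x'\<in>{x - K..x + K}. b)"
      proof (rule sum_mono)
        fix x'
        have "N.prob (E x') \<le> 9 / (lam * sqrt (c u))"
          unfolding E_def using True k lam by (intro prob_gw_generations_le) auto
        also have "\<dots> \<le> b"
          unfolding b_def using True k lam
          by (intro divide_left_mono mult_left_mono mult_pos_pos)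
            (auto simp: real_sqrt_le_iff simp flip: of_nat_mult)
        finally show "N.prob (E x') \<le> b" .
      qed
      \<comment> \<open>Only an inequality, since the subtraction \<open>x - K\<close> on naturals
        truncates at 0 and may shorten the interval.\<close>
      also have "\<dots> \<le> real (2 * K + 1) * b"
      proof -
        have "real (card {x - K..x + K}) * b \<le> real (2 * K + 1) * b"
          using lam by (intro mult_right_mono) (auto simp: b_def simp del: of_nat_Suc)
        then show ?thesis by simp
      qed
      finally show ?thesis .
    qed
  qed
qed

text \<open>The degree caps confine a matching to labels up to \<open>9 * k\<close>, and restricting
  \<open>f\<close> to \<open>I\<close> makes it extensional. Only finitely many pairs
  \<open>(I, f)\<close> are left for the union bound.\<close>

lemma corr_Suc_tree_of:
  assumes "corr k K (Suc n) (tree_of c) (tree_of c')"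
  obtains I f where "I \<subseteq> {1..9 * k}" "card I = k" "f \<in> I \<rightarrow>\<^sub>E {1..9 * k}" "inj_on f I"
    "\<And>i. i \<in> I \<Longrightarrow> corr k K n (tree_of (\<lambda>m. c (i # m))) (tree_of (\<lambda>m. c' (f i # m)))"
proof -
  obtain I f where I: "card I = k" "inj_on f I"
    "\<And>i. i \<in> I \<Longrightarrow> [i] \<in> tree_of c \<and> [f i] \<in> tree_of c' \<and>
      corr k K n (subtree (tree_of c) i) (subtree (tree_of c') (f i))"
    and le: "c [] \<le> 9 * k" "c' [] \<le> 9 * k"
    using assms by (auto simp: gen_size_1_tree_of)
  have mem: "i \<in> {1..c []}" "f i \<in> {1..c' []}" if "i \<in> I" for i
    using I(3)[OF that] unfolding singleton_mem_tree_of by auto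
  show thesis
  proof (rule that[of I "restrict f I"])
    show "I \<subseteq> {1..9 * k}" "restrict f I \<in> I \<rightarrow>\<^sub>E {1..9 * k}" using mem le by fastforce+
    fix i assume i: "i \<in> I"
    show "corr k K n (tree_of (\<lambda>m. c (i # m))) (tree_of (\<lambda>m. c' (restrict f I i # m)))"
      using I(3)[OF i] i by (simp only: subtree_tree_of mem[OF i] restrict_apply if_True)
  qed (use I in \<open>auto simp: inj_on_def\<close>)
qed

lemma disjoint_descendants:
  "inj_on f J \<Longrightarrow> disjoint_family_on (\<lambda>i. descendants (u @ [f i])) J"
  by (auto simp: disjoint_family_on_def descendants_def inj_on_def)

text \<open>For a fixed matching the \<open>k\<close> pairs of subtrees use disjoint sets of
  coordinates in both trees, by injectivity of \<open>f\<close> in the second one. The joint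
  probability is therefore at most \<open>q ^ k\<close>. There are at most
  \<open>2 ^ (9 * k)\<close> sets \<open>I\<close> and \<open>(9 * k) ^ k\<close> maps on
  each.\<close>

lemma prob_null_corr_Suc:
  fixes lam q :: real
  assumes q: "\<And>u u'. measure (null_space lam) {\<omega> \<in> space (null_space lam). null_corr k K n u u' \<omega>} \<le> q"
  shows "measure (null_space lam) {\<omega> \<in> space (null_space lam). null_corr k K (Suc n) u u' \<omega>} \<le>
    2 ^ (9 * k) * (9 * real k) ^ k * q ^ k"
proof -
  interpret prob_space "null_space lam" by (rule prob_space_null_space)
  have q0: "0 \<le> q" using q[of u u'] measure_nonneg order_trans by blast
  let ?C = "gw_gen lam"
  note gw = indep_gen_gw[of lam]
  have coord: "?C (v @ m) \<subseteq> sets (gen_alg (gw_space lam) ?C (descendants v))" for v m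
    using sets_gen_algI[OF gw, of "descendants v" "v @ m"] by (auto simp: descendants_def)
  define X where "X = (SIGMA I:{I. I \<subseteq> {1..9 * k} \<and> card I = k}. {f \<in> I \<rightarrow>\<^sub>E {1..9 * k}. inj_on f I})"
  define E where "E = (\<lambda>(I, f). {\<omega> \<in> space (null_space lam).
      \<forall>i\<in>I. null_corr k K n (u @ [i]) (u' @ [f i]) \<omega>})"
  have fin: "finite I" if "I \<subseteq> {1..9 * k}" for I using that finite_subset by blast
  have fin_inj: "finite {f \<in> I \<rightarrow>\<^sub>E {1..9 * k}. inj_on f I}" if "I \<subseteq> {1..9 * k}" for I
    by (rule finite_subset[of _ "I \<rightarrow>\<^sub>E {1..9 * k}"]) (use fin[OF that] in \<open>auto intro!: finite_PiE\<close>)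
  have "finite X" unfolding X_def using fin_inj by (intro finite_SigmaI) auto
  have ev: "E x \<in> events" if "x \<in> X" for x
  proof -
    obtain I f where x: "x = (I, f)" by (cases x)
    then have [measurable]: "finite I" using that fin by (auto simp: X_def)
    show ?thesis unfolding E_def x prod.case by measurable
  qed
  have sub: "{\<omega> \<in> space (null_space lam). null_corr k K (Suc n) u u' \<omega>} \<subseteq> (\<Union>x\<in>X. E x)"
  proof
    fix \<omega> assume \<omega>: "\<omega> \<in> {\<omega> \<in> space (null_space lam). null_corr k K (Suc n) u u' \<omega>}"
    then have "corr k K (Suc n) (tree_of (shift u (fst \<omega>))) (tree_of (shift u' (snd \<omega>)))"
      unfolding null_corr_def by blast
    then obtain I f where I: "I \<subseteq> {1..9 * k}" "card I = k" "f \<in> I \<rightarrow>\<^sub>E {1..9 * k}" "inj_on f I"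
      "\<And>i. i \<in> I \<Longrightarrow> corr k K n (tree_of (\<lambda>m. shift u (fst \<omega>) (i # m)))
        (tree_of (\<lambda>m. shift u' (snd \<omega>) (f i # m)))"
      by (rule corr_Suc_tree_of) blast
    then have "(I, f) \<in> X" "\<omega> \<in> E (I, f)"
      using \<omega> by (auto simp: X_def E_def null_corr_def shift_Cons)
    then show "\<omega> \<in> (\<Union>x\<in>X. E x)" by blast
  qed
  have E_le: "prob (E x) \<le> q ^ k" if "x \<in> X" for x
  proof -
    obtain I f where x: "x = (I, f)" by (cases x)
    with that have I: "I \<subseteq> {1..9 * k}" "card I = k" "inj_on f I" by (auto simp: X_def)
    define F where "F i = sets (gen_alg (gw_space lam) ?C (descendants (u @ [i])))" for i
    \<comment> \<open>The second tree is indexed by the label \<open>i\<close> of the partner, so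
      that both families share the index set \<open>I\<close> and can be zipped.\<close>
    define G where "G i = sets (gen_alg (gw_space lam) ?C (descendants (u' @ [f i])))" for i
    have F: "indep_gen (gw_space lam) F I"
      unfolding F_def using disjoint_descendants[of "\<lambda>i. i" I u]
      by (intro indep_gen_block[OF gw]) auto
    have G: "indep_gen (gw_space lam) G I"
      unfolding G_def using disjoint_descendants[OF I(3), of u']
      by (intro indep_gen_block[OF gw]) auto
    have "prob {\<omega> \<in> space (null_space lam). \<forall>i\<in>I. null_corr k K n (u @ [i]) (u' @ [f i]) \<omega>} \<le> q ^ card I"
      unfolding null_space_def
    proof (rule indep_gen_prob_le[OF indep_gen_zip[OF F G], where L = "\<lambda>i. {i}"])
      fix i assume i: "i \<in> I"
      then have L: "{i} \<subseteq> I" by simp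
      have "shift (u @ [i]) \<in> gen_alg (gw_space lam) F {i} \<rightarrow>\<^sub>M gw_space lam"
        by (rule measurable_shift[OF F L], rule bexI[of _ i], unfold F_def, rule coord) simp
      note 1 = measurable_compose[OF measurable_fst_zip[OF F G L] this]
      have "shift (u' @ [f i]) \<in> gen_alg (gw_space lam) G {i} \<rightarrow>\<^sub>M gw_space lam"
        by (rule measurable_shift[OF G L], rule bexI[of _ i], unfold G_def, rule coord) simp
      note 2 = measurable_compose[OF measurable_snd_zip[OF F G L] this]
      show "Measurable.pred (gen_alg (gw_space lam \<Otimes>\<^sub>M gw_space lam) (zip_sets F G) {i})
          (null_corr k K n (u @ [i]) (u' @ [f i]))"
        by (rule measurable_null_corr_comp[OF 1 2])
      show "measure (gw_space lam \<Otimes>\<^sub>M gw_space lam) {\<omega> \<in> space (gw_space lam \<Otimes>\<^sub>M gw_space lam).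
          null_corr k K n (u @ [i]) (u' @ [f i]) \<omega>} \<le> q"
        using q by (simp add: null_space_def)
    qed (use I fin in \<open>auto simp: disjoint_family_on_def\<close>)
    then show ?thesis by (simp add: E_def x I)
  qed
  have "prob {\<omega> \<in> space (null_space lam). null_corr k K (Suc n) u u' \<omega>} \<le> prob (\<Union>x\<in>X. E x)"
    using sub ev \<open>finite X\<close> by (intro finite_measure_mono) auto
  also have "\<dots> \<le> (\<Sum>x\<in>X. prob (E x))"
    using ev \<open>finite X\<close> by (intro finite_measure_subadditive_finite) auto
  also have "\<dots> \<le> (\<Sum>x\<in>X. q ^ k)" by (intro sum_mono E_le)
  also have "\<dots> = card X * q ^ k" by simp
  also have "\<dots> \<le> 2 ^ (9 * k) * (9 * real k) ^ k * q ^ k"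
  proof (rule mult_right_mono)
    have "card X = (\<Sum>I\<in>{I. I \<subseteq> {1..9 * k} \<and> card I = k}. card {f \<in> I \<rightarrow>\<^sub>E {1..9 * k}. inj_on f I})"
      unfolding X_def using fin_inj by (intro card_SigmaI) auto
    also have "\<dots> \<le> (\<Sum>I\<in>{I. I \<subseteq> {1..9 * k} \<and> card I = k}. (9 * k) ^ k)"
    proof (rule sum_mono)
      fix I assume I: "I \<in> {I. I \<subseteq> {1..9 * k} \<and> card I = k}"
      then have "card {f \<in> I \<rightarrow>\<^sub>E {1..9 * k}. inj_on f I} \<le> card (I \<rightarrow>\<^sub>E {1..9 * k})"
        using fin by (intro card_mono finite_PiE) auto
      also have "\<dots> = (9 * k) ^ k" using I fin by (simp add: card_PiE)
      finally show "card {f \<in> I \<rightarrow>\<^sub>E {1..9 * k}. inj_on f I} \<le> (9 * k) ^ k" .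
    qed
    also have "\<dots> = card {I. I \<subseteq> {1..9 * k} \<and> card I = k} * (9 * k) ^ k" by simp
    also have "card {I. I \<subseteq> {1..9 * k} \<and> card I = k} \<le> card (Pow {1..9 * k})"
      by (intro card_mono) auto
    finally have "card X \<le> 2 ^ (9 * k) * (9 * k) ^ k" by (simp add: card_Pow)
    then have "real (card X) \<le> real (2 ^ (9 * k) * (9 * k) ^ k)" by (simp only: of_nat_le_iff)
    then show "real (card X) \<le> 2 ^ (9 * k) * (9 * real k) ^ k" by simp
  qed (use q0 in simp)
  finally show ?thesis .
qed

lemma prob_null_corr:
  fixes lam :: real
  assumes lam: "0 < lam" and k: "0 < k" "9216 * k \<le> 2 ^ (k - 1)"
    and K: "real (2 * K + 1) * (9 / (lam * sqrt (2 * k))) \<le> 1 / (9216 * real k)"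
  shows "measure (null_space lam) {\<omega> \<in> space (null_space lam). null_corr k K n u u' \<omega>} \<le>
    (1 / 2) ^ n / (9216 * real k)"
proof (induction n arbitrary: u u')
  case 0
  show ?case using prob_null_corr_0[OF lam k(1), of K u u'] K by simp
next
  case (Suc n)
  let ?q = "(1 / 2) ^ n / (9216 * real k)"
  have "measure (null_space lam) {\<omega> \<in> space (null_space lam). null_corr k K (Suc n) u u' \<omega>} \<le>
      2 ^ (9 * k) * (9 * real k) ^ k * ?q ^ k"
    by (rule prob_null_corr_Suc) (rule Suc)
  also have "\<dots> = (2 ^ 9 * (9 * real k) * ?q) ^ k"
    by (simp only: power_mult_distrib power_mult)
  \<comment> \<open>Here \<open>9216 = 2 * 2 ^ 9 * 9\<close>: the base of the power equals half of
    \<open>(1 / 2) ^ n\<close>.\<close>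
  also have "2 ^ 9 * (9 * real k) * ?q = (1 / 2) ^ Suc n"
    using k(1) by (simp add: field_simps)
  \<comment> \<open>One of the \<open>k\<close> factors provides the new geometric decay; the other
    \<open>k - 1\<close> restore the prefactor \<open>1 / (9216 * k)\<close>.\<close>
  also have "((1 / 2) ^ Suc n) ^ k = (1 / 2 :: real) ^ Suc n * ((1 / 2) ^ Suc n) ^ (k - 1)"
    using k(1) by (metis power_minus_mult mult.commute)
  also have "\<dots> \<le> (1 / 2) ^ Suc n * (1 / (9216 * real k))"
  proof (rule mult_left_mono)
    have "((1 / 2) ^ Suc n) ^ (k - 1) \<le> (1 / 2 :: real) ^ (k - 1)"
      by (intro power_mono) (simp_all add: power_le_one)
    also have "\<dots> = 1 / 2 ^ (k - 1)" by (simp add: power_one_over)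
    also have "\<dots> \<le> 1 / real (9216 * k)"
    proof (rule divide_left_mono)
      have "real (9216 * k) \<le> real (2 ^ (k - 1))" using k(2) by (simp only: of_nat_le_iff)
      then show "real (9216 * k) \<le> 2 ^ (k - 1)" by simp
    qed (use k(1) in auto)
    finally show "((1 / 2) ^ Suc n) ^ (k - 1) \<le> 1 / (9216 * real k)" by simp
  qed simp
  finally show ?case by simp
qed

subsection \<open>Correlated trees under the planted law\<close>

lemma measure_pair_fst:
  assumes "prob_space M" "prob_space N" "Measurable.pred M Q"
  shows "measure (M \<Otimes>\<^sub>M N) {\<omega> \<in> space (M \<Otimes>\<^sub>M N). Q (fst \<omega>)} = measure M {x \<in> space M. Q x}"
proof -
  interpret M: prob_space M by fact
  interpret N: prob_space N by fact
  have "{\<omega> \<in> space (M \<Otimes>\<^sub>M N). Q (fst \<omega>)} = {x \<in> space M. Q x} \<times> space N"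
    by (auto simp: space_pair_measure)
  moreover have "{x \<in> space M. Q x} \<in> sets M" using assms(3) by measurable
  ultimately show ?thesis
    by (simp add: measure_def N.emeasure_pair_measure_Times N.emeasure_space_1)
qed

lemma measure_pair_snd:
  assumes "prob_space M" "prob_space N" "Measurable.pred N Q"
  shows "measure (M \<Otimes>\<^sub>M N) {\<omega> \<in> space (M \<Otimes>\<^sub>M N). Q (snd \<omega>)} = measure N {x \<in> space N. Q x}"
proof -
  interpret M: prob_space M by fact
  interpret N: prob_space N by fact
  have "{\<omega> \<in> space (M \<Otimes>\<^sub>M N). Q (snd \<omega>)} = space M \<times> {x \<in> space N. Q x}"
    by (auto simp: space_pair_measure)
  moreover have "{x \<in> space N. Q x} \<in> sets N" using assms(3) by measurable
  ultimately show ?thesis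
    by (simp add: measure_def N.emeasure_pair_measure_Times M.emeasure_space_1)
qed

lemma (in prob_space) prob_disj_le:
  assumes "Measurable.pred M Q" "Measurable.pred M R"
    and "\<And>\<omega>. \<omega> \<in> space M \<Longrightarrow> P \<omega> \<Longrightarrow> Q \<omega> \<or> R \<omega>"
    and "prob {\<omega> \<in> space M. Q \<omega>} \<le> a" "prob {\<omega> \<in> space M. R \<omega>} \<le> b"
  shows "prob {\<omega> \<in> space M. P \<omega>} \<le> a + b"
proof -
  have [measurable]: "Measurable.pred M Q" "Measurable.pred M R" by fact+
  have "prob {\<omega> \<in> space M. P \<omega>} \<le> prob ({\<omega> \<in> space M. Q \<omega>} \<union> {\<omega> \<in> space M. R \<omega>})"
    using assms(3) by (intro finite_measure_mono) auto
  also have "\<dots> \<le> prob {\<omega> \<in> space M. Q \<omega>} + prob {\<omega> \<in> space M. R \<omega>}"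
    by (intro measure_Un_le) auto
  finally show ?thesis using assms(4,5) by simp
qed

lemma pred_gw_coord: "Measurable.pred (gw_space \<mu>) (\<lambda>c. Q (c u))"
  by (rule measurable_compose[OF measurable_gw_coord]) simp

text \<open>On a countable space it suffices to compare point masses, which
  \<open>prob_gw_sum\<close> gives with no prescribed coordinates.\<close>

lemma distr_gw_sum:
  fixes \<mu> :: real
  assumes "0 \<le> \<mu>" "finite A"
  shows "distr (gw_space \<mu>) (count_space UNIV) (\<lambda>c. \<Sum>m\<in>A. c m) =
    measure_pmf (poisson (card A * \<mu>))"
proof (rule measure_eqI_countable[of _ UNIV])
  fix x :: nat
  have *: "(\<lambda>c. \<Sum>m\<in>A. c m) \<in> gw_space \<mu> \<rightarrow>\<^sub>M count_space UNIV" by measurable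
  have "emeasure (distr (gw_space \<mu>) (count_space UNIV) (\<lambda>c. \<Sum>m\<in>A. c m)) {x} =
      emeasure (gw_space \<mu>) {c. (\<Sum>m\<in>A. c m) = x}"
    by (subst emeasure_distr[OF *]) (simp_all add: vimage_def)
  also have "\<dots> = ennreal (measure (gw_space \<mu>) {c. (\<Sum>m\<in>A. c m) = x})"
    by (intro finite_measure.emeasure_eq_measure prob_space.finite_measure prob_space_gw_space)
  also have "measure (gw_space \<mu>) {c. (\<Sum>m\<in>A. c m) = x} = pmf (poisson (card A * \<mu>)) x"
    using prob_gw_sum[OF assms, of "{}" "\<lambda>_. 0" x] by simp
  finally show "emeasure (distr (gw_space \<mu>) (count_space UNIV) (\<lambda>c. \<Sum>m\<in>A. c m)) {x} =
      emeasure (measure_pmf (poisson (card A * \<mu>))) {x}" by (simp add: emeasure_pmf_single)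
qed auto

lemma prob_gw_sum_Collect:
  fixes \<mu> :: real
  assumes "0 \<le> \<mu>" "finite A"
  shows "measure (gw_space \<mu>) {c. Q (\<Sum>m\<in>A. c m)} =
    measure_pmf.prob (poisson (card A * \<mu>)) {x. Q x}"
proof -
  have *: "(\<lambda>c. \<Sum>m\<in>A. c m) \<in> gw_space \<mu> \<rightarrow>\<^sub>M count_space UNIV" by measurable
  have "measure (gw_space \<mu>) {c. Q (\<Sum>m\<in>A. c m)} =
      measure (distr (gw_space \<mu>) (count_space UNIV) (\<lambda>c. \<Sum>m\<in>A. c m)) {x. Q x}"
    by (subst measure_distr[OF *]) (simp_all add: vimage_def)
  then show ?thesis by (simp add: distr_gw_sum[OF assms])
qed

lemma prob_gw_coord:
  fixes \<mu> :: real
  assumes "0 \<le> \<mu>"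
  shows "measure (gw_space \<mu>) {c. Q (c u)} = measure_pmf.prob (poisson \<mu>) {x. Q x}"
  using prob_gw_sum_Collect[OF assms, of "{u}" Q] by simp

section \<open>Subtrees of augmented trees and independence of the planted sample\<close>

definition ashift :: "label \<Rightarrow> aug_sample \<Rightarrow> aug_sample" where
  "ashift u a = (shift u (fst a), \<lambda>(m, j). snd a (u @ m, j))"

lemma subtree_augment_shift:
  assumes "i \<in> {1..c u}"
  shows "subtree (augment (ashift u a) (tree_of (shift u c))) i =
    augment (ashift (u @ [i]) a) (tree_of (shift (u @ [i]) c))"
proof -
  have i: "i \<in> {1..shift u c []}" using assms by (simp add: shift_def)
  have "[i] \<in> tree_of (shift u c)" using i unfolding singleton_mem_tree_of .
  note subtree_augment[OF canonical_tree_of this, of "shift u (fst a)" "\<lambda>(m, j). snd a (u @ m, j)"]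
  then show ?thesis
    unfolding subtree_tree_of[of i "shift u c", OF i] shift_Cons by (simp add: ashift_def)
qed

lemma gen_size_1_augment_shift:
  "gen_size (Suc 0) (augment (ashift u a) (tree_of (shift u c))) = c u + fst a u"
  by (simp add: ashift_def gen_size_1_augment[OF canonical_tree_of] gen_size_1_tree_of shift_def)

lemma gen_size_2_augment_shift:
  assumes "fst a u = 0"
  shows "gen_size 2 (augment (ashift u a) (tree_of (shift u c))) =
    (\<Sum>i=1..c u. c (u @ [i])) + (\<Sum>i=1..c u. fst a (u @ [i]))"
proof -
  have "{i. [i] \<in> tree_of (shift u c)} = {1..c u}"
    unfolding singleton_mem_tree_of by (auto simp: shift_def)
  then show ?thesis
    using assms by (simp add: ashift_def gen_size_2_augment[OF canonical_tree_of] gen_size_2_tree_of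
        shift_def)
qed

lemma aug_space_eq:
  "aug_space lam s = gw_space (lam * (1 - s)) \<Otimes>\<^sub>M PiM UNIV (\<lambda>_. gw_space lam)"
  by (simp add: aug_space_def gw_space_def[of "lam * (1 - s)"])

text \<open>The grafted copies are indexed by pairs of a label and a number. Collecting all numbers
  belonging to one label gives a family indexed by labels, as zipping with the offspring numbers
  demands.\<close>

definition copies_gen :: "real \<Rightarrow> label \<Rightarrow> (label \<times> nat \<Rightarrow> label \<Rightarrow> nat) set set" where
  "copies_gen lam m = sets (gen_alg (PiM UNIV (\<lambda>_. gw_space lam))
     (coord_sets (\<lambda>_. gw_space lam)) ({m} \<times> UNIV))"

lemma indep_gen_copies: "indep_gen (PiM UNIV (\<lambda>_. gw_space lam)) (copies_gen lam) UNIV"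
  unfolding copies_gen_def[abs_def]
  by (rule indep_gen_block[OF indep_gen_PiM[OF prob_space_gw_space]])
    (auto simp: disjoint_family_on_def)

definition aug_gen :: "real \<Rightarrow> real \<Rightarrow> label \<Rightarrow> aug_sample set set" where
  "aug_gen lam s = zip_sets (gw_gen (lam * (1 - s))) (copies_gen lam)"

lemma indep_gen_aug: "indep_gen (aug_space lam s) (aug_gen lam s) UNIV"
  unfolding aug_space_eq aug_gen_def by (rule indep_gen_zip[OF indep_gen_gw indep_gen_copies])

lemma measurable_shift_gen:
  "shift u \<in> gen_alg (gw_space \<mu>) (gw_gen \<mu>) (descendants u) \<rightarrow>\<^sub>M gw_space \<mu>"
  by (rule measurable_shift[OF indep_gen_gw]) (auto simp: descendants_def)

lemma measurable_ashift_gen: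
  "ashift u \<in> gen_alg (aug_space lam s) (aug_gen lam s) (descendants u) \<rightarrow>\<^sub>M aug_space lam s"
proof -
  note fst = measurable_fst_zip[OF indep_gen_gw indep_gen_copies subset_UNIV]
  note snd = measurable_snd_zip[OF indep_gen_gw indep_gen_copies subset_UNIV]
  have copies: "(\<lambda>G (m, j). G (u @ m, j)) \<in>
      gen_alg (PiM UNIV (\<lambda>_. gw_space lam)) (copies_gen lam) (descendants u) \<rightarrow>\<^sub>M
      PiM UNIV (\<lambda>_. gw_space lam)"
  proof (rule measurable_PiM_single')
    fix x :: "label \<times> nat"
    obtain m j where x: "x = (m, j)" by (cases x)
    have "coord_sets (\<lambda>_. gw_space lam) (u @ m, j) \<subseteq> copies_gen lam (u @ m)"
      unfolding copies_gen_def
      using sets_gen_algI[OF indep_gen_PiM[of "\<lambda>_. gw_space lam", OF prob_space_gw_space] subset_UNIV,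
          of "(u @ m, j)" "{u @ m} \<times> UNIV"] by blast
    then have "(\<lambda>G. G (u @ m, j)) \<in>
        gen_alg (PiM UNIV (\<lambda>_. gw_space lam)) (copies_gen lam) (descendants u) \<rightarrow>\<^sub>M gw_space lam"
      by (intro measurable_coord_gen[OF indep_gen_copies subset_UNIV]) (auto simp: descendants_def)
    then show "(\<lambda>G. (case x of (m, j) \<Rightarrow> G (u @ m, j))) \<in>
        gen_alg (PiM UNIV (\<lambda>_. gw_space lam)) (copies_gen lam) (descendants u) \<rightarrow>\<^sub>M gw_space lam"
      by (simp add: x)
  qed simp
  show ?thesis
    unfolding ashift_def[abs_def] aug_space_eq aug_gen_def
    by (rule measurable_Pair[OF measurable_compose[OF fst measurable_shift_gen]
          measurable_compose[OF snd copies]])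
qed

text \<open>The events of interest are read off before relabelling, so the trivial family at each
  label is enough to zip the permutations with the other components.\<close>

definition relabel_gen :: "label \<Rightarrow> relabel_sample set set" where
  "relabel_gen m = {space relabel_space}"

lemma indep_gen_relabel: "indep_gen relabel_space relabel_gen UNIV"
proof -
  interpret prob_space relabel_space by (rule prob_space_relabel_space)
  have "indep_sets relabel_gen UNIV"
    unfolding indep_sets_def
  proof (intro conjI ballI allI impI)
    fix J X assume "J \<noteq> {}" "X \<in> Pi J relabel_gen"
    then have "\<And>j. j \<in> J \<Longrightarrow> X j \<in> relabel_gen j" by blast
    then have X: "\<And>j. j \<in> J \<Longrightarrow> X j = space relabel_space" by (simp add: relabel_gen_def)
    then have "(\<Inter>j\<in>J. X j) = space relabel_space" using \<open>J \<noteq> {}\<close> by auto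
    then show "prob (\<Inter>j\<in>J. X j) = (\<Prod>j\<in>J. prob (X j))" using X by (simp add: prob_space)
  qed (auto simp: relabel_gen_def)
  then show ?thesis
    by (simp add: indep_gen_def prob_space_axioms relabel_gen_def Int_stable_def)
qed

definition planted_gen :: "real \<Rightarrow> real \<Rightarrow> label \<Rightarrow> planted_sample set set" where
  "planted_gen lam s = zip_sets (gw_gen (lam * s))
     (zip_sets (zip_sets (aug_gen lam s) relabel_gen) (zip_sets (aug_gen lam s) relabel_gen))"

lemmas indep_gen_aug_relabel = indep_gen_zip[OF indep_gen_aug indep_gen_relabel]
lemmas indep_gen_aug_relabel_pair = indep_gen_zip[OF indep_gen_aug_relabel indep_gen_aug_relabel]

lemma indep_gen_planted: "indep_gen (planted_space lam s) (planted_gen lam s) UNIV"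
  unfolding planted_space_def planted_gen_def
  by (rule indep_gen_zip[OF indep_gen_gw indep_gen_aug_relabel_pair])

text \<open>Both trees are taken before relabelling and at the same label \<open>u\<close>;
  \<open>corr_relabel\<close> later transfers the relation to the relabelled trees.\<close>

definition planted_corr :: "nat \<Rightarrow> nat \<Rightarrow> nat \<Rightarrow> label \<Rightarrow> planted_sample \<Rightarrow> bool" where
  "planted_corr k K n u \<omega> \<longleftrightarrow>
     corr k K n (augment (ashift u (fst (fst (snd \<omega>)))) (tree_of (shift u (fst \<omega>))))
       (augment (ashift u (fst (snd (snd \<omega>)))) (tree_of (shift u (fst \<omega>))))"

text \<open>The event depends only on the sample attached to descendants of \<open>u\<close>. Hence
  the events at different children of a label are independent.\<close>

lemma measurable_planted_corr_gen:
  "Measurable.pred (gen_alg (planted_space lam s) (planted_gen lam s) (descendants u))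
     (planted_corr k K n u)"
proof -
  let ?M = "gen_alg (planted_space lam s) (planted_gen lam s) (descendants u)"
  note U = subset_UNIV[of "descendants u"]
  have 0: "(\<lambda>\<omega>. shift u (fst \<omega>)) \<in> ?M \<rightarrow>\<^sub>M gw_space (lam * s)"
    unfolding planted_space_def planted_gen_def
    by (rule measurable_compose[OF
          measurable_fst_zip[OF indep_gen_gw indep_gen_aug_relabel_pair U] measurable_shift_gen])
  note snd = measurable_snd_zip[OF indep_gen_gw indep_gen_aug_relabel_pair U]
  have 1: "(\<lambda>\<omega>. ashift u (fst (fst (snd \<omega>)))) \<in> ?M \<rightarrow>\<^sub>M aug_space lam s"
    unfolding planted_space_def planted_gen_def
    by (rule measurable_compose[OF measurable_compose[OF measurable_compose[OF snd
            measurable_fst_zip[OF indep_gen_aug_relabel indep_gen_aug_relabel U]]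
          measurable_fst_zip[OF indep_gen_aug indep_gen_relabel U]] measurable_ashift_gen])
  have 2: "(\<lambda>\<omega>. ashift u (fst (snd (snd \<omega>)))) \<in> ?M \<rightarrow>\<^sub>M aug_space lam s"
    unfolding planted_space_def planted_gen_def
    by (rule measurable_compose[OF measurable_compose[OF measurable_compose[OF snd
            measurable_snd_zip[OF indep_gen_aug_relabel indep_gen_aug_relabel U]]
          measurable_fst_zip[OF indep_gen_aug indep_gen_relabel U]] measurable_ashift_gen])
  show ?thesis
    unfolding planted_corr_def[abs_def]
    by (intro measurable_corr measurable_mem_augment[OF measurable_mem_tree_of[OF 0] 1]
        measurable_mem_augment[OF measurable_mem_tree_of[OF 0] 2]
        canonical_augment canonical_tree_of)
qed

lemma measurable_planted_corr [measurable]: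
  "Measurable.pred (planted_space lam s) (planted_corr k K n u)"
  using measurable_planted_corr_gen[where lam = lam and s = s and u = u and k = k and K = K and n = n]
    sets_gen_alg_subset[OF indep_gen_planted subset_UNIV, of lam s "descendants u"]
  unfolding pred_def space_gen_alg by blast

section \<open>Sufficient conditions for correlation of the planted trees\<close>

definition irregular :: "nat \<Rightarrow> label \<Rightarrow> planted_sample \<Rightarrow> bool" where
  "irregular k u \<omega> \<longleftrightarrow> fst \<omega> u \<notin> {2 * k..9 * k} \<or>
     fst (fst (fst (snd \<omega>))) u \<noteq> 0 \<or> fst (fst (snd (snd \<omega>))) u \<noteq> 0"

text \<open>Without new children at \<open>u\<close> and with at least \<open>2 * k\<close> old
  ones, the labels in \<open>I\<close> name the same old children in both trees, so the identity is
  a valid matching.\<close>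

lemma planted_corr_SucI:
  assumes "\<not> irregular k u \<omega>" and I: "I \<subseteq> {1..2 * k}" "card I = k"
    and corr: "\<And>i. i \<in> I \<Longrightarrow> planted_corr k K n (u @ [i]) \<omega>"
  shows "planted_corr k K (Suc n) u \<omega>"
proof -
  define c a a' where "c = fst \<omega>" and "a = fst (fst (snd \<omega>))" and "a' = fst (snd (snd \<omega>))"
  have reg: "2 * k \<le> c u" "c u \<le> 9 * k" "fst a u = 0" "fst a' u = 0"
    using assms(1) by (auto simp: irregular_def c_def a_def a'_def)
  have mem: "[i] \<in> augment (ashift u b) (tree_of (shift u c))" if "i \<in> {1..c u}" for b i
    using that singleton_mem_tree_of[of i "shift u c"]
    by (simp add: augment_def shift_def split: prod.split)
  have i: "i \<in> {1..c u}" if "i \<in> I" for i using that I reg by force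
  have "\<exists>I f. card I = k \<and> inj_on f I \<and>
      (\<forall>i\<in>I. [i] \<in> augment (ashift u a) (tree_of (shift u c)) \<and>
        [f i] \<in> augment (ashift u a') (tree_of (shift u c)) \<and>
        corr k K n (subtree (augment (ashift u a) (tree_of (shift u c))) i)
          (subtree (augment (ashift u a') (tree_of (shift u c))) (f i)))"
    using I corr mem i
    by (intro exI[of _ I] exI[of _ id])
      (simp add: subtree_augment_shift planted_corr_def c_def a_def a'_def)
  then show ?thesis
    using reg by (simp add: planted_corr_def gen_size_1_augment_shift c_def a_def a'_def)
qed

text \<open>The old nodes of the second generation are common to both trees and cancel. The
  remaining difference is between the two counts of new nodes, both within \<open>K / 2\<close> of
  the same centre \<open>\<mu>\<close>.\<close>

lemma planted_corr_0I:
  assumes "\<not> irregular k u \<omega>"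
    and "\<bar>real (\<Sum>i=1..fst \<omega> u. fst (fst (fst (snd \<omega>))) (u @ [i])) - \<mu>\<bar> < K / 2"
    and "\<bar>real (\<Sum>i=1..fst \<omega> u. fst (fst (snd (snd \<omega>))) (u @ [i])) - \<mu>\<bar> < K / 2"
  shows "planted_corr k K 0 u \<omega>"
proof -
  define c a a' where "c = fst \<omega>" and "a = fst (fst (snd \<omega>))" and "a' = fst (snd (snd \<omega>))"
  define X X' where "X = (\<Sum>i=1..c u. fst a (u @ [i]))" and "X' = (\<Sum>i=1..c u. fst a' (u @ [i]))"
  have reg: "2 * k \<le> c u" "c u \<le> 9 * k" "fst a u = 0" "fst a' u = 0"
    using assms(1) by (auto simp: irregular_def c_def a_def a'_def)
  have "\<bar>real X - real X'\<bar> < K"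
    using assms(2,3) unfolding X_def X'_def c_def a_def a'_def by linarith
  then have "\<bar>int X - int X'\<bar> \<le> int K" by linarith
  then show ?thesis
    unfolding planted_corr_def c_def[symmetric] a_def[symmetric] a'_def[symmetric]
    using reg by (simp add: gen_size_1_augment_shift gen_size_2_augment_shift X_def X'_def)
qed

section \<open>Failure probabilities under the planted law\<close>

context
  fixes lam s :: real and k :: nat
  assumes lam: "0 < lam" and s: "0 \<le> s" "s \<le> 1"
    and k: "0 < k" "3 * k \<le> lam * s" "lam * s \<le> 6 * k"
begin

abbreviation "pairs \<equiv> (aug_space lam s \<Otimes>\<^sub>M relabel_space) \<Otimes>\<^sub>M (aug_space lam s \<Otimes>\<^sub>M relabel_space)"

lemma prob_space_aug_relabel: "prob_space (aug_space lam s \<Otimes>\<^sub>M relabel_space)"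
  by (intro prob_space_pair prob_space_aug_space prob_space_relabel_space)

lemma prob_space_pairs: "prob_space pairs"
  by (intro prob_space_pair prob_space_aug_relabel)

text \<open>Events about the new offspring numbers of either augmentation are reduced to the product
  of Poisson laws, by integrating out the copies, the permutations and the other
  augmentation.\<close>

lemma prob_aug:
  assumes Q: "Measurable.pred (gw_space (lam * (1 - s))) Q"
  shows "Measurable.pred pairs (\<lambda>y. Q (fst (fst (fst y))))"
    "Measurable.pred pairs (\<lambda>y. Q (fst (fst (snd y))))"
    "measure pairs {y \<in> space pairs. Q (fst (fst (fst y)))} =
      measure (gw_space (lam * (1 - s))) {N. Q N}"
    "measure pairs {y \<in> space pairs. Q (fst (fst (snd y)))} =
      measure (gw_space (lam * (1 - s))) {N. Q N}"
proof -
  have copies: "prob_space (PiM UNIV (\<lambda>_::label \<times> nat. gw_space lam))"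
    by (intro prob_space_PiM prob_space_gw_space)
  have 1: "Measurable.pred (aug_space lam s) (\<lambda>a. Q (fst a))"
    unfolding aug_space_eq by (rule measurable_compose[OF measurable_fst Q])
  have 2: "Measurable.pred (aug_space lam s \<Otimes>\<^sub>M relabel_space) (\<lambda>y. Q (fst (fst y)))"
    by (rule measurable_compose[OF measurable_fst 1])
  show "Measurable.pred pairs (\<lambda>y. Q (fst (fst (fst y))))"
    "Measurable.pred pairs (\<lambda>y. Q (fst (fst (snd y))))"
    by (rule measurable_compose[OF measurable_fst 2] measurable_compose[OF measurable_snd 2])+
  have eq: "measure (aug_space lam s \<Otimes>\<^sub>M relabel_space)
      {y \<in> space (aug_space lam s \<Otimes>\<^sub>M relabel_space). Q (fst (fst y))} =
      measure (gw_space (lam * (1 - s))) {N. Q N}"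
    using measure_pair_fst[OF prob_space_aug_space prob_space_relabel_space 1]
      measure_pair_fst[OF prob_space_gw_space copies Q, folded aug_space_eq] by simp
  show "measure pairs {y \<in> space pairs. Q (fst (fst (fst y)))} =
      measure (gw_space (lam * (1 - s))) {N. Q N}"
    using measure_pair_fst[OF prob_space_aug_relabel prob_space_aug_relabel 2] eq by simp
  show "measure pairs {y \<in> space pairs. Q (fst (fst (snd y)))} =
      measure (gw_space (lam * (1 - s))) {N. Q N}"
    using measure_pair_snd[OF prob_space_aug_relabel prob_space_aug_relabel 2] eq by simp
qed

lemma measurable_planted_coords:
  "(\<lambda>\<omega>. fst \<omega> u) \<in> planted_space lam s \<rightarrow>\<^sub>M count_space UNIV"
  "(\<lambda>\<omega>. fst (fst (fst (snd \<omega>))) u) \<in> planted_space lam s \<rightarrow>\<^sub>M count_space UNIV"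
  "(\<lambda>\<omega>. fst (fst (snd (snd \<omega>))) u) \<in> planted_space lam s \<rightarrow>\<^sub>M count_space UNIV"
  unfolding planted_space_def aug_space_eq
  by (rule measurable_compose[OF _ measurable_gw_coord], measurable)+

lemma pred_planted_coords:
  "Measurable.pred (planted_space lam s) (\<lambda>\<omega>. Q (fst \<omega> u))"
  "Measurable.pred (planted_space lam s) (\<lambda>\<omega>. Q (fst (fst (fst (snd \<omega>))) u))"
  "Measurable.pred (planted_space lam s) (\<lambda>\<omega>. Q (fst (fst (snd (snd \<omega>))) u))"
  by (rule measurable_planted_coords[THEN measurable_compose], simp)+

lemma pred_new_children: "Measurable.pred (planted_space lam s)
    (\<lambda>\<omega>. fst (fst (fst (snd \<omega>))) u \<noteq> 0 \<or> fst (fst (snd (snd \<omega>))) u \<noteq> 0)"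
  by (intro pred_intros_logic(5) pred_planted_coords(2,3)[where Q = "\<lambda>x. x \<noteq> 0"])

lemma measurable_irregular [measurable]: "Measurable.pred (planted_space lam s) (irregular k u)"
  unfolding irregular_def[abs_def]
  by (intro pred_intros_logic(5) pred_new_children
      pred_planted_coords(1)[where Q = "\<lambda>x. x \<notin> {2 * k..9 * k}"])

text \<open>Chebyshev's inequality for the degree gives \<open>6 / k\<close>. Each augmentation adds
  a child with probability \<open>1 - exp (- \<epsilon>)\<close>, which is at most
  \<open>\<epsilon>\<close>.\<close>

lemma prob_irregular:
  "measure (planted_space lam s) {\<omega> \<in> space (planted_space lam s). irregular k u \<omega>} \<le>
    6 / real k + 2 * (lam * (1 - s))"
proof -
  define \<epsilon> where "\<epsilon> = lam * (1 - s)"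
  have \<epsilon>: "0 \<le> \<epsilon>" using lam s by (simp add: \<epsilon>_def)
  interpret prob_space "planted_space lam s" by (rule prob_space_planted_space)
  have N: "Measurable.pred (gw_space (lam * (1 - s))) (\<lambda>N. N u \<noteq> 0)"
    by (rule pred_gw_coord[where Q = "\<lambda>x. x \<noteq> 0"])
  have new: "measure (gw_space (lam * (1 - s))) {N. N u \<noteq> 0} \<le> \<epsilon>"
  proof -
    have "measure (gw_space (lam * (1 - s))) {N. N u \<noteq> 0} = measure_pmf.prob (poisson \<epsilon>) {x. x \<noteq> 0}"
      using prob_gw_coord[OF \<epsilon>, of "\<lambda>x. x \<noteq> 0" u] by (simp add: \<epsilon>_def)
    also have "{x. x \<noteq> 0} = space (measure_pmf (poisson \<epsilon>)) - {0::nat}" by auto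
    also have "measure_pmf.prob (poisson \<epsilon>) \<dots> = 1 - pmf (poisson \<epsilon>) 0"
      by (subst measure_pmf.prob_compl) (simp_all add: measure_pmf_single)
    also have "\<dots> \<le> \<epsilon>"
      using \<epsilon> exp_ge_add_one_self[of "- \<epsilon>"] by (simp add: pmf_poisson_rate)
    finally show ?thesis .
  qed
  have "prob {\<omega> \<in> space (planted_space lam s). irregular k u \<omega>} \<le> 6 / real k + (\<epsilon> + \<epsilon>)"
  proof (rule prob_disj_le)
    show "Measurable.pred (planted_space lam s) (\<lambda>\<omega>. fst \<omega> u \<notin> {2 * k..9 * k})"
      by (rule pred_planted_coords(1)[where Q = "\<lambda>x. x \<notin> {2 * k..9 * k}"])
    have "prob {\<omega> \<in> space (planted_space lam s). fst \<omega> u \<notin> {2 * k..9 * k}} =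
        measure (gw_space (lam * s)) {c. c u \<notin> {2 * k..9 * k}}"
      unfolding planted_space_def
      using measure_pair_fst[OF prob_space_gw_space prob_space_pairs
          pred_gw_coord[where Q = "\<lambda>x. x \<notin> {2 * k..9 * k}"]] by simp
    also have "\<dots> = measure_pmf.prob (poisson (lam * s)) {x. x \<notin> {2 * k..9 * k}}"
      using lam s by (intro prob_gw_coord) simp
    \<comment> \<open>Since the mean lies between \<open>3 * k\<close> and \<open>6 * k\<close>,
      leaving the range from \<open>2 * k\<close> to \<open>9 * k\<close> means deviating by at
      least \<open>k\<close>.\<close>
    also have "\<dots> \<le> measure_pmf.prob (poisson (lam * s)) {x. real k \<le> \<bar>real x - lam * s\<bar>}"
      using k by (intro measure_pmf.finite_measure_mono) auto
    also have "\<dots> \<le> lam * s / (real k)\<^sup>2"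
      using lam s k by (intro poisson_Chebyshev) auto
    also have "\<dots> \<le> 6 * k / (real k)\<^sup>2" using k by (intro divide_right_mono) auto
    also have "\<dots> = 6 / real k" by (simp add: power2_eq_square)
    finally show "prob {\<omega> \<in> space (planted_space lam s). fst \<omega> u \<notin> {2 * k..9 * k}} \<le> 6 / real k" .
    show "Measurable.pred (planted_space lam s)
        (\<lambda>\<omega>. fst (fst (fst (snd \<omega>))) u \<noteq> 0 \<or> fst (fst (snd (snd \<omega>))) u \<noteq> 0)"
      by (rule pred_new_children)
    show "prob {\<omega> \<in> space (planted_space lam s).
        fst (fst (fst (snd \<omega>))) u \<noteq> 0 \<or> fst (fst (snd (snd \<omega>))) u \<noteq> 0} \<le> \<epsilon> + \<epsilon>"
    proof (rule prob_disj_le)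
      show "Measurable.pred (planted_space lam s) (\<lambda>\<omega>. fst (fst (fst (snd \<omega>))) u \<noteq> 0)"
        "Measurable.pred (planted_space lam s) (\<lambda>\<omega>. fst (fst (snd (snd \<omega>))) u \<noteq> 0)"
        by (rule pred_planted_coords(2,3)[where Q = "\<lambda>x. x \<noteq> 0"])+
      show "prob {\<omega> \<in> space (planted_space lam s). fst (fst (fst (snd \<omega>))) u \<noteq> 0} \<le> \<epsilon>"
        using measure_pair_snd[OF prob_space_gw_space prob_space_pairs prob_aug(1)[OF N], of "lam * s"]
          prob_aug(3)[OF N] new by (simp add: planted_space_def)
      show "prob {\<omega> \<in> space (planted_space lam s). fst (fst (snd (snd \<omega>))) u \<noteq> 0} \<le> \<epsilon>"
        using measure_pair_snd[OF prob_space_gw_space prob_space_pairs prob_aug(2)[OF N], of "lam * s"]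
          prob_aug(4)[OF N] new by (simp add: planted_space_def)
    qed
  qed (auto simp: irregular_def)
  then show ?thesis by (simp add: \<epsilon>_def)
qed

lemma prob_not_planted_corr_0:
  assumes K: "0 < K"
  shows "measure (planted_space lam s) {\<omega> \<in> space (planted_space lam s). \<not> planted_corr k K 0 u \<omega>} \<le>
    6 / real k + 2 * (lam * (1 - s)) + 72 * real k * (lam * (1 - s)) / (real K)\<^sup>2"
proof -
  define \<epsilon> where "\<epsilon> = lam * (1 - s)"
  have \<epsilon>: "0 \<le> \<epsilon>" using lam s by (simp add: \<epsilon>_def)
  interpret prob_space "planted_space lam s" by (rule prob_space_planted_space)
  \<comment> \<open>The number \<open>j\<close> of summands stands for the random degree of
    \<open>u\<close>. The clause \<open>j \<le> 9 * k\<close> makes the bound \<open>b\<close>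
    uniform in \<open>j\<close>.\<close>
  define dev where "dev j N \<longleftrightarrow> j \<le> 9 * k \<and> K / 2 \<le> \<bar>real (\<Sum>i=1..j. N (u @ [i])) - j * \<epsilon>\<bar>"
    for j :: nat and N :: "label \<Rightarrow> nat"
  have dev_meas: "Measurable.pred (gw_space (lam * (1 - s))) (dev j)" for j
    unfolding dev_def[abs_def] by measurable
  define b where "b = 36 * k * \<epsilon> / (real K)\<^sup>2"
  have b0: "0 \<le> b" using \<epsilon> by (simp add: b_def)
  have dev_le: "measure (gw_space (lam * (1 - s))) {N. dev j N} \<le> b" for j
  proof (cases "j \<le> 9 * k")
    case True
    have "measure (gw_space (lam * (1 - s))) {N. dev j N} =
        measure_pmf.prob (poisson (j * \<epsilon>)) {x. K / 2 \<le> \<bar>real x - j * \<epsilon>\<bar>}"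
      using prob_gw_sum_Collect[OF \<epsilon>, of "(\<lambda>i. u @ [i]) ` {1..j}" "\<lambda>x. K / 2 \<le> \<bar>real x - j * \<epsilon>\<bar>"] True
      by (simp add: dev_def sum.reindex inj_on_snoc card_image \<epsilon>_def)
    \<comment> \<open>The number of new nodes below \<open>j\<close> old children is Poisson with
      mean and variance \<open>j * \<epsilon>\<close>.\<close>
    also have "\<dots> \<le> j * \<epsilon> / (K / 2)\<^sup>2"
      using \<epsilon> K by (intro poisson_Chebyshev) auto
    also have "\<dots> \<le> (9 * k) * \<epsilon> / (K / 2)\<^sup>2"
      using True \<epsilon> by (intro divide_right_mono mult_right_mono) auto
    also have "\<dots> = b" by (simp add: b_def power_divide)
    finally show ?thesis .
  next
    case False
    then show ?thesis using b0 by (simp add: dev_def)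
  qed
  have pair_meas: "Measurable.pred (planted_space lam s) (\<lambda>\<omega>. dev (fst \<omega> u) (fst (fst (fst (snd \<omega>)))))"
    "Measurable.pred (planted_space lam s) (\<lambda>\<omega>. dev (fst \<omega> u) (fst (fst (snd (snd \<omega>)))))"
  proof -
    note * = measurable_compose_countable[OF _ measurable_planted_coords(1)]
    show "Measurable.pred (planted_space lam s) (\<lambda>\<omega>. dev (fst \<omega> u) (fst (fst (fst (snd \<omega>)))))"
      by (rule *, unfold planted_space_def)
        (rule measurable_compose[OF measurable_snd prob_aug(1)[OF dev_meas]])
    show "Measurable.pred (planted_space lam s) (\<lambda>\<omega>. dev (fst \<omega> u) (fst (fst (snd (snd \<omega>)))))"
      by (rule *, unfold planted_space_def)
        (rule measurable_compose[OF measurable_snd prob_aug(2)[OF dev_meas]])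
  qed
  have "prob {\<omega> \<in> space (planted_space lam s). \<not> planted_corr k K 0 u \<omega>} \<le>
      6 / real k + 2 * (lam * (1 - s)) + (b + b)"
  proof (rule prob_disj_le[OF measurable_irregular _ _ prob_irregular])
    show "Measurable.pred (planted_space lam s) (\<lambda>\<omega>. dev (fst \<omega> u) (fst (fst (fst (snd \<omega>)))) \<or>
        dev (fst \<omega> u) (fst (fst (snd (snd \<omega>)))))"
      using pair_meas by measurable
    show "prob {\<omega> \<in> space (planted_space lam s). dev (fst \<omega> u) (fst (fst (fst (snd \<omega>)))) \<or>
        dev (fst \<omega> u) (fst (fst (snd (snd \<omega>))))} \<le> b + b"
    proof (rule prob_disj_le[OF pair_meas])
      show "prob {\<omega> \<in> space (planted_space lam s). dev (fst \<omega> u) (fst (fst (fst (snd \<omega>))))} \<le> b"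
        unfolding planted_space_def
        \<comment> \<open>Conditioning on the common tree turns its random degree into a fixed
          \<open>j\<close>, independent of the augmentation.\<close>
        by (rule measure_pair_le[OF prob_space_gw_space prob_space_pairs
              pair_meas(1)[unfolded planted_space_def] b0])
          (simp add: prob_aug(3)[OF dev_meas] dev_le)
      show "prob {\<omega> \<in> space (planted_space lam s). dev (fst \<omega> u) (fst (fst (snd (snd \<omega>))))} \<le> b"
        unfolding planted_space_def
        by (rule measure_pair_le[OF prob_space_gw_space prob_space_pairs
              pair_meas(2)[unfolded planted_space_def] b0])
          (simp add: prob_aug(4)[OF dev_meas] dev_le)
    qed
    fix \<omega> assume "\<not> planted_corr k K 0 u \<omega>"
    then show "irregular k u \<omega> \<or> dev (fst \<omega> u) (fst (fst (fst (snd \<omega>)))) \<or>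
        dev (fst \<omega> u) (fst (fst (snd (snd \<omega>))))"
      using planted_corr_0I[of k u \<omega> "fst \<omega> u * \<epsilon>" K] by (force simp: dev_def irregular_def not_le)
  qed
  then show ?thesis by (simp add: b_def \<epsilon>_def mult_ac)
qed

text \<open>On the regular event, failure leaves a set \<open>R\<close> of \<open>k\<close> failing
  children among the first \<open>2 * k\<close>. There are at most \<open>2 ^ (2 * k)\<close> such
  sets, and the \<open>k\<close> failures in each are independent.\<close>

lemma prob_not_planted_corr_Suc:
  assumes q: "\<And>u. measure (planted_space lam s)
      {\<omega> \<in> space (planted_space lam s). \<not> planted_corr k K n u \<omega>} \<le> q"
  shows "measure (planted_space lam s) {\<omega> \<in> space (planted_space lam s). \<not> planted_corr k K (Suc n) u \<omega>} \<le>
    6 / real k + 2 * (lam * (1 - s)) + (4 * q) ^ k"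
proof -
  interpret prob_space "planted_space lam s" by (rule prob_space_planted_space)
  have q0: "0 \<le> q" using q[of u] measure_nonneg order_trans by blast
  define X where "X = {R. R \<subseteq> {1..2 * k} \<and> card R = k}"
  define E where "E R = {\<omega> \<in> space (planted_space lam s). \<forall>i\<in>R. \<not> planted_corr k K n (u @ [i]) \<omega>}" for R
  have finX: "finite X" unfolding X_def by (rule finite_subset[of _ "Pow {1..2 * k}"]) auto
  have fin: "finite R" if "R \<in> X" for R using that finite_subset unfolding X_def by blast
  have ev: "E R \<in> events" if "R \<in> X" for R
  proof -
    have [measurable]: "finite R" using that by (rule fin)
    show ?thesis unfolding E_def by measurable
  qed
  have E_le: "prob (E R) \<le> q ^ k" if "R \<in> X" for R
  proof -
    have "prob (E R) \<le> q ^ card R"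
      unfolding E_def
    proof (rule indep_gen_prob_le[OF indep_gen_planted fin[OF that],
          where L = "\<lambda>i. descendants (u @ [i])"])
      show "disjoint_family_on (\<lambda>i. descendants (u @ [i])) R"
        using disjoint_descendants[of "\<lambda>i. i" R u] by simp
      fix i
      show "Measurable.pred (gen_alg (planted_space lam s) (planted_gen lam s) (descendants (u @ [i])))
          (\<lambda>\<omega>. \<not> planted_corr k K n (u @ [i]) \<omega>)"
        using measurable_planted_corr_gen by measurable
    qed (use q in auto)
    then show ?thesis using that by (simp add: X_def)
  qed
  have "prob {\<omega> \<in> space (planted_space lam s). \<not> planted_corr k K (Suc n) u \<omega>} \<le>
      6 / real k + 2 * (lam * (1 - s)) + 2 ^ (2 * k) * q ^ k"
  proof (rule prob_disj_le[OF measurable_irregular _ _ prob_irregular])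
    have UN: "{\<omega> \<in> space (planted_space lam s). \<omega> \<in> (\<Union>R\<in>X. E R)} = (\<Union>R\<in>X. E R)"
      by (auto simp: E_def)
    show "Measurable.pred (planted_space lam s) (\<lambda>\<omega>. \<omega> \<in> (\<Union>R\<in>X. E R))"
      unfolding pred_def UN using ev finX by auto
    have "prob (\<Union>R\<in>X. E R) \<le> (\<Sum>R\<in>X. prob (E R))"
      using ev finX by (intro finite_measure_subadditive_finite) auto
    also have "\<dots> \<le> (\<Sum>R\<in>X. q ^ k)" by (intro sum_mono E_le)
    also have "\<dots> = card X * q ^ k" by simp
    also have "\<dots> \<le> 2 ^ (2 * k) * q ^ k"
    proof (rule mult_right_mono)
      have "card X \<le> card (Pow {1..2 * k})" unfolding X_def by (intro card_mono) auto
      then have "real (card X) \<le> real (2 ^ (2 * k))" by (simp only: of_nat_le_iff) (simp add: card_Pow)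
      then show "real (card X) \<le> 2 ^ (2 * k)" by simp
    qed (use q0 in simp)
    finally show "prob {\<omega> \<in> space (planted_space lam s). \<omega> \<in> (\<Union>R\<in>X. E R)} \<le> 2 ^ (2 * k) * q ^ k"
      unfolding UN .
    fix \<omega> assume \<omega>: "\<omega> \<in> space (planted_space lam s)" "\<not> planted_corr k K (Suc n) u \<omega>"
    show "irregular k u \<omega> \<or> \<omega> \<in> (\<Union>R\<in>X. E R)"
    proof (rule ccontr)
      assume neg: "\<not> (irregular k u \<omega> \<or> \<omega> \<in> (\<Union>R\<in>X. E R))"
      define S where "S = {i \<in> {1..2 * k}. planted_corr k K n (u @ [i]) \<omega>}"
      \<comment> \<open>Any \<open>k\<close> successful children would be a matching; so fewer than
        \<open>k\<close> of the \<open>2 * k\<close> succeed and at least \<open>k\<close>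
        fail.\<close>
      have "card S < k"
      proof (rule ccontr)
        assume "\<not> card S < k"
        then obtain I where "I \<subseteq> S" "card I = k"
          by (meson not_less obtain_subset_with_card_n)
        then have "planted_corr k K (Suc n) u \<omega>"
          using neg by (intro planted_corr_SucI[of k u \<omega> I]) (auto simp: S_def)
        then show False using \<omega> by simp
      qed
      moreover have "card ({1..2 * k} - S) = 2 * k - card S"
        by (subst card_Diff_subset) (auto simp: S_def)
      ultimately have "k \<le> card ({1..2 * k} - S)" by linarith
      then obtain R where "R \<subseteq> {1..2 * k} - S" "card R = k"
        by (rule obtain_subset_with_card_n)
      then have "R \<in> X" "\<omega> \<in> E R" using \<omega> by (auto simp: X_def E_def S_def)
      then show False using neg by blast
    qed
  qed
  then show ?thesis by (simp add: power_mult power_mult_distrib)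
qed

text \<open>The value \<open>1 / 16\<close> reproduces itself because
  \<open>4 * (1 / 16) = 1 / 4\<close>, and the second numerical assumption absorbs
  \<open>(1 / 4) ^ k\<close> and the irregular event.\<close>

lemma prob_not_planted_corr:
  assumes K: "0 < K" and "6 / real k + 2 * (lam * (1 - s)) + 72 * real k * (lam * (1 - s)) / (real K)\<^sup>2 \<le> 1 / 16"
    "6 / real k + 2 * (lam * (1 - s)) + (1 / 4) ^ k \<le> 1 / 16"
  shows "measure (planted_space lam s) {\<omega> \<in> space (planted_space lam s). \<not> planted_corr k K n u \<omega>} \<le> 1 / 16"
proof (induction n arbitrary: u)
  case 0
  show ?case using prob_not_planted_corr_0[OF K, of u] assms(2) by linarith
next
  case (Suc n)
  show ?case using prob_not_planted_corr_Suc[OF Suc, of u] assms(3) by simp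
qed

end

subsection \<open>The test\<close>

text \<open>Trees of depth \<open>n\<close> determine \<open>corr\<close> up to level
  \<open>n - 2\<close>. Below depth 2 the test always answers 0, which affects neither
  limit.\<close>

definition corr_test :: "nat \<Rightarrow> nat \<Rightarrow> nat \<Rightarrow> tree \<times> tree \<Rightarrow> nat" where
  "corr_test k K n x = (if 2 \<le> n \<and> corr k K (n - 2) (fst x) (snd x) then 1 else 0)"

lemma measure_null_law:
  "measure (null_law lam (n + 2))
      {x \<in> trees_upto (n + 2) \<times> trees_upto (n + 2). corr_test k K (n + 2) x = 1} =
    measure (null_space lam) {\<omega> \<in> space (null_space lam). null_corr k K n [] [] \<omega>}"
proof -
  have "corr_test k K (n + 2) (map_prod (prune (n + 2)) (prune (n + 2)) (null_trees \<omega>)) = 1 \<longleftrightarrow>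
      null_corr k K n [] [] \<omega>" for \<omega>
    by (cases \<omega>) (simp add: corr_test_def null_trees_def null_corr_def corr_prune shift_def[abs_def])
  moreover have "map_prod (prune (n + 2)) (prune (n + 2)) (null_trees \<omega>) \<in>
      trees_upto (n + 2) \<times> trees_upto (n + 2)" for \<omega>
    by (cases \<omega>) (simp add: null_trees_def prune_in_trees_upto canonical_tree_of)
  ultimately show ?thesis
    unfolding null_law_def
    by (subst measure_distr[OF measurable_null_trees])
      (auto intro!: arg_cong[of _ _ "measure (null_space lam)"])
qed

text \<open>Correlation before relabelling implies correlation afterwards, and this one implication
  already gives the lower bound on the acceptance probability.\<close>

lemma measure_planted_law_ge:
  "measure (planted_space lam s) {\<omega> \<in> space (planted_space lam s). planted_corr k K n [] \<omega>} \<le>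
    measure (planted_law lam s (n + 2))
      {x \<in> trees_upto (n + 2) \<times> trees_upto (n + 2). corr_test k K (n + 2) x = 1}"
proof -
  interpret prob_space "planted_space lam s" by (rule prob_space_planted_space)
  let ?f = "\<lambda>\<omega>. map_prod (prune (n + 2)) (prune (n + 2)) (planted_trees \<omega>)"
  let ?A = "{x \<in> trees_upto (n + 2) \<times> trees_upto (n + 2). corr_test k K (n + 2) x = 1}"
  have "{\<omega> \<in> space (planted_space lam s). planted_corr k K n [] \<omega>} \<subseteq>
      ?f -` ?A \<inter> space (planted_space lam s)"
  proof
    fix \<omega> assume "\<omega> \<in> {\<omega> \<in> space (planted_space lam s). planted_corr k K n [] \<omega>}"
    then have \<omega>: "\<omega> \<in> space (planted_space lam s)" and pc: "planted_corr k K n [] \<omega>" by auto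
    obtain c a \<sigma> a' \<sigma>' where eq: "\<omega> = (c, (a, \<sigma>), (a', \<sigma>'))" by (metis surj_pair)
    have \<sigma>: "\<sigma> \<in> space relabel_space" "\<sigma>' \<in> space relabel_space"
      using \<omega> by (auto simp: eq planted_space_def space_pair_measure)
    then have inj: "inj (\<sigma> (m, d))" "inj (\<sigma>' (m, d))" for m d
      unfolding space_relabel_space by (blast intro: permutes_inj)+
    have "corr k K n (augment a (tree_of c)) (augment a' (tree_of c))"
      using pc by (simp add: planted_corr_def eq shift_def[abs_def] ashift_def case_prod_eta)
    then have "corr k K n (relabel \<sigma> (augment a (tree_of c))) (relabel \<sigma>' (augment a' (tree_of c)))"
      using inj by (rule corr_relabel)
    then have "corr_test k K (n + 2) (?f \<omega>) = 1"
      by (simp add: corr_test_def planted_trees_def eq corr_prune)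
    moreover have "?f \<omega> \<in> trees_upto (n + 2) \<times> trees_upto (n + 2)"
      by (rule measurable_space[OF measurable_planted_trees[of "n + 2" lam s] \<omega>,
            unfolded space_count_space])
    ultimately show "\<omega> \<in> ?f -` ?A \<inter> space (planted_space lam s)" using \<omega> by simp
  qed
  moreover have "?f -` ?A \<inter> space (planted_space lam s) \<in> events"
    by (rule measurable_sets[OF measurable_planted_trees]) auto
  ultimately have "prob {\<omega> \<in> space (planted_space lam s). planted_corr k K n [] \<omega>} \<le>
      prob (?f -` ?A \<inter> space (planted_space lam s))"
    by (rule finite_measure_mono)
  also have "\<dots> = measure (planted_law lam s (n + 2)) ?A"
    unfolding planted_law_def by (rule measure_distr[OF measurable_planted_trees, symmetric]) auto
  finally show ?thesis .
qed

lemma one_sided_test_corr_test: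
  fixes lam s :: real
  assumes lam: "0 < lam" and s: "0 \<le> s" "s \<le> 1"
    and k: "0 < k" "3 * real k \<le> lam * s" "lam * s \<le> 6 * real k" "9216 * k \<le> 2 ^ (k - 1)"
    and K: "0 < K" "real (2 * K + 1) * (9 / (lam * sqrt (2 * real k))) \<le> 1 / (9216 * real k)"
    and p: "6 / real k + 2 * (lam * (1 - s)) + 72 * real k * (lam * (1 - s)) / (real K)\<^sup>2 \<le> 1 / 16"
      "6 / real k + 2 * (lam * (1 - s)) + (1 / 4) ^ k \<le> 1 / 16"
  shows "one_sided_test lam s (corr_test k K)"
proof -
  have "(\<lambda>n. measure (null_law lam (n + 2))
      {x \<in> trees_upto (n + 2) \<times> trees_upto (n + 2). corr_test k K (n + 2) x = 1}) \<longlonglongrightarrow> 0"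
  proof (rule tendsto_sandwich[OF _ _ tendsto_const])
    show "(\<lambda>n. (1 / 2) ^ n / (9216 * real k)) \<longlonglongrightarrow> 0"
      by (intro tendsto_divide_zero LIMSEQ_power_zero) simp
    show "\<forall>\<^sub>F n in sequentially. measure (null_law lam (n + 2))
        {x \<in> trees_upto (n + 2) \<times> trees_upto (n + 2). corr_test k K (n + 2) x = 1} \<le>
        (1 / 2) ^ n / (9216 * real k)"
      unfolding measure_null_law using prob_null_corr[OF lam k(1,4), of K] K(2) by simp
  qed simp
  then have null: "(\<lambda>n. measure (null_law lam n)
      {x \<in> trees_upto n \<times> trees_upto n. corr_test k K n x = 1}) \<longlonglongrightarrow> 0"
    by (rule LIMSEQ_offset)
  have "15 / 16 \<le> measure (planted_law lam s n) {x \<in> trees_upto n \<times> trees_upto n. corr_test k K n x = 1}"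
    if "2 \<le> n" for n
  proof -
    interpret prob_space "planted_space lam s" by (rule prob_space_planted_space)
    have n: "n = n - 2 + 2" using that by simp
    have "prob {\<omega> \<in> space (planted_space lam s). \<not> planted_corr k K (n - 2) [] \<omega>} \<le> 1 / 16"
      using lam s k K p by (intro prob_not_planted_corr) auto
    moreover have "prob {\<omega> \<in> space (planted_space lam s). \<not> planted_corr k K (n - 2) [] \<omega>} =
        1 - prob {\<omega> \<in> space (planted_space lam s). planted_corr k K (n - 2) [] \<omega>}"
      by (rule prob_neg) measurable
    ultimately show ?thesis using measure_planted_law_ge[of lam s k K "n - 2", folded n] by linarith
  qed
  then have "\<forall>\<^sub>F n in sequentially. ereal (15 / 16) \<le>
      ereal (measure (planted_law lam s n) {x \<in> trees_upto n \<times> trees_upto n. corr_test k K n x = 1})"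
    by (auto simp: eventually_sequentially)
  from Liminf_bounded[OF this]
  have "0 < liminf (\<lambda>n. ereal (measure (planted_law lam s n)
      {x \<in> trees_upto n \<times> trees_upto n. corr_test k K n x = 1}))"
    by (rule less_le_trans[rotated]) simp
  with null show ?thesis
    by (auto simp: one_sided_test_def corr_test_def)
qed

section \<open>Choice of the constants\<close>

lemma linear_le_power_two:
  assumes "30 \<le> k" shows "9216 * k \<le> (2 :: nat) ^ (k - 1)"
  using assms
proof (induction k rule: nat_induct_at_least)
  case (Suc k)
  then have "2 ^ (Suc k - 1) = 2 * (2 :: nat) ^ (k - 1)" by (cases k) auto
  then show ?case using Suc by simp
qed simp

theorem theorem5:
  shows "\<exists>r\<^sub>0::real. \<forall>lam s :: real.
    lam > 0 \<longrightarrow> s \<in> {0..1} \<longrightarrow> lam * s > r\<^sub>0 \<longrightarrow>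
    (\<exists>\<eta>>0. 1 - s \<le> 1 / (3 + \<eta>) * sqrt (ln (lam * s) / (lam ^ 3 * s))) \<longrightarrow>
    (\<exists>T. one_sided_test lam s T)"
proof -
  \<comment> \<open>The hypothesis will bound \<open>lam * (1 - s)\<close> by this expression at
    \<open>r = lam * s\<close>.\<close>
  have "((\<lambda>r::real. sqrt (ln r / r)) \<longlongrightarrow> 0) at_top" by real_asymp
  then have "\<forall>\<^sub>F r in at_top. sqrt (ln r / r) < 1 / 10 ^ 15"
    by (rule order_tendstoD) simp
  then obtain r1 :: real where r1: "\<And>r. r1 \<le> r \<Longrightarrow> sqrt (ln r / r) < 1 / 10 ^ 15"
    by (auto simp: eventually_at_top_linorder)
  show ?thesis
  \<comment> \<open>The bound \<open>10 ^ 13\<close> ensures that \<open>k\<close>, about a quarter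
    of \<open>lam\<close>, is at least \<open>10 ^ 12\<close>.\<close>
  proof (intro exI[of _ "max r1 (10 ^ 13)"] allI impI)
    fix lam s :: real
    assume lam: "0 < lam" and s: "s \<in> {0..1}" and r: "max r1 (10 ^ 13) < lam * s"
      and "\<exists>\<eta>>0. 1 - s \<le> 1 / (3 + \<eta>) * sqrt (ln (lam * s) / (lam ^ 3 * s))"
    then obtain \<eta> where \<eta>: "0 < \<eta>" "1 - s \<le> 1 / (3 + \<eta>) * sqrt (ln (lam * s) / (lam ^ 3 * s))"
      by blast
    define \<epsilon> where "\<epsilon> = lam * (1 - s)"
    have s01: "0 \<le> s" "s \<le> 1" using s by auto
    have "0 < lam * s" using r by simp
    then have s_pos: "0 < s" using lam by (rule zero_less_mult_pos)
    have ln0: "0 \<le> ln (lam * s)" using r by simp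
    have \<epsilon>0: "0 \<le> \<epsilon>" using lam s01 by (simp add: \<epsilon>_def)
    have \<epsilon>: "\<epsilon> \<le> 1 / 10 ^ 15"
    proof -
      \<comment> \<open>The factor \<open>1 / (3 + \<eta>)\<close> is at most 1. Multiplying by
        \<open>lam\<close> then cancels two powers of \<open>lam\<close> under the root.\<close>
      have "1 - s \<le> 1 * sqrt (ln (lam * s) / (lam ^ 3 * s))"
        using \<eta>(1) ln0 lam s01
        by (intro order_trans[OF \<eta>(2)] mult_right_mono) auto
      then have "\<epsilon> \<le> lam * sqrt (ln (lam * s) / (lam ^ 3 * s))"
        unfolding \<epsilon>_def using lam by (intro mult_left_mono) auto
      also have "\<dots> = sqrt (lam\<^sup>2 * (ln (lam * s) / (lam ^ 3 * s)))"
        using lam by (simp only: real_sqrt_mult) simp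
      also have "lam\<^sup>2 * (ln (lam * s) / (lam ^ 3 * s)) = ln (lam * s) / (lam * s)"
        using lam s_pos by (simp add: field_simps power2_eq_square power3_eq_cube)
      also have "sqrt \<dots> < 1 / 10 ^ 15" using r by (intro r1) simp
      finally show ?thesis by simp
    qed
    \<comment> \<open>As \<open>lam * s\<close> is almost \<open>lam\<close>, it is about
      \<open>4 * k\<close>, well inside the required range from \<open>3 * k\<close> to
      \<open>6 * k\<close>.\<close>
    define k where "k = nat \<lfloor>lam / 4\<rfloor>"
    have lam_r: "lam * s = lam - \<epsilon>" by (simp add: \<epsilon>_def algebra_simps)
    have lam_big: "10 ^ 13 < lam" using lam_r \<epsilon>0 r by simp
    have k1: "4 * real k \<le> lam" "lam < 4 * real k + 4" unfolding k_def using lam by linarith+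
    have k_big: "10 ^ 12 \<le> real k" using k1(2) lam_big by simp
    then have "real 30 \<le> real k" by simp
    then have "30 \<le> k" by (simp only: of_nat_le_iff)
    \<comment> \<open>A compromise: \<open>K\<close> is small enough for the null bound at level 0,
      yet its square, of order \<open>k / 10 ^ 10\<close>, dominates the variance
      \<open>k * \<epsilon>\<close> with \<open>\<epsilon> \<le> 1 / 10 ^ 15\<close>.\<close>
    define K where "K = nat \<lfloor>sqrt k / 100000\<rfloor>"
    have sk: "1000000 \<le> sqrt k" using k_big by (intro real_le_rsqrt) simp
    have K1: "real K \<le> sqrt k / 100000" "sqrt k / 100000 < real K + 1"
      proof -
      have "0 \<le> sqrt k / 100000" by simp
      then show "real K \<le> sqrt k / 100000" "sqrt k / 100000 < real K + 1"
        unfolding K_def by linarith+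
    qed
    have K2: "sqrt k / 200000 \<le> real K" using K1(2) sk by simp
    have K0: "0 < K" using K2 sk by linarith
    have "one_sided_test lam s (corr_test k K)"
    proof (rule one_sided_test_corr_test[OF lam s01])
      show "0 < k" using \<open>30 \<le> k\<close> by simp
      show "3 * real k \<le> lam * s" "lam * s \<le> 6 * real k"
        using k1 k_big \<epsilon> \<epsilon>0 unfolding lam_r by simp_all
      show "9216 * k \<le> 2 ^ (k - 1)" by (rule linear_le_power_two) fact
      show "0 < K" by fact
      show "real (2 * K + 1) * (9 / (lam * sqrt (2 * real k))) \<le> 1 / (9216 * real k)"
      proof -
        have "sqrt (real k) \<le> sqrt (2 * real k)" by simp
        then have "4 * real k * sqrt k \<le> lam * sqrt (2 * real k)"
          using k1 lam by (intro mult_mono) auto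
        then have A: "9 / (lam * sqrt (2 * real k)) \<le> 9 / (4 * real k * sqrt k)"
          using lam \<open>30 \<le> k\<close> by (intro divide_left_mono mult_pos_pos) auto
        \<comment> \<open>The constant is \<open>20736 = 9216 * 9 / 4\<close>, chosen to produce
          exactly \<open>1 / (9216 * k)\<close> below.\<close>
        have "real (2 * K + 1) \<le> sqrt k / 20736" using K1 sk by simp
        then have "real (2 * K + 1) * (9 / (lam * sqrt (2 * real k))) \<le>
            (sqrt k / 20736) * (9 / (4 * real k * sqrt k))"
          by (rule mult_mono[OF _ A]) (use lam in auto)
        also have "\<dots> = 1 / (9216 * real k)" using k_big by simp
        finally show ?thesis .
      qed
      have "6 / real k \<le> 6 / 10 ^ 12" using k_big by (intro divide_left_mono) auto
      then have small: "6 / real k + 2 * (lam * (1 - s)) \<le> 1 / 100" using \<epsilon> by (simp add: \<epsilon>_def)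
      have "72 * real k * (lam * (1 - s)) / (real K)\<^sup>2 \<le> 72 * real k * (1 / 10 ^ 15) / (sqrt k / 200000)\<^sup>2"
        using \<epsilon> \<epsilon>0 K2 sk \<open>30 \<le> k\<close> unfolding \<epsilon>_def[symmetric]
        by (intro frac_le mult_left_mono mult_nonneg_nonneg power_mono) auto
      also have "\<dots> \<le> 1 / 100" using k_big by (simp add: power_divide)
      finally show "6 / real k + 2 * (lam * (1 - s)) + 72 * real k * (lam * (1 - s)) / (real K)\<^sup>2 \<le> 1 / 16"
        using small by simp
      have "(1 / 4 :: real) ^ k \<le> (1 / 4) ^ 3" using \<open>30 \<le> k\<close> by (intro power_decreasing) auto
      then show "6 / real k + 2 * (lam * (1 - s)) + (1 / 4) ^ k \<le> 1 / 16"
        using small by (simp add: power3_eq_cube)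
    qed
    then show "\<exists>T. one_sided_test lam s T" by blast
  qed
qed

end
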